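(* Let $u_h$, with $u_h(\cdot,t)\in V_h$, solve the forced damped second-order semidiscrete problem: for all $t\ge0$ and $v_h\in V_h$, $$\left(\tfrac1Hu_{h,tt},v_h\right)+\tfrac1\epsilon\left(\tfrac fHu_{h,t}^\perp,v_h\right)+\tfrac{\beta}{\epsilon^2}\left(\nabla\cdot u_h,\nabla\cdot v_h\right)+\left(\tfrac CHu_{h,t},v_h\right)=(\widetilde F,v_h),$$ and let $E(t)=\tfrac12\|u_{h,t}\|_{1/H}^2+\tfrac{\beta}{2\epsilon^2}\|\nabla\cdot u_h\|^2$. Define $$\alpha_1=\frac{\sqrt{\beta H_*}}{2C_P\epsilon},\qquad \alpha_2=\frac{2C_*}{1+\chi},\qquad \chi=2+\frac{C_P^2(1+\epsilon C^* )^2}{\beta H_*}.$$ Then for any $0<\alpha\le\min\{\alpha_1,\alpha_2\}$ and $$K_\alpha\equiv\frac12\left[1+\frac{\alpha^2C_P^2\epsilon^2}{\beta H_*^2}\right],$$ we have the bound, for $t\ge0$, $$E(t)\le 3e^{-\frac{\alpha}{3}t}E(0)+\frac{K_\alpha}{\alpha}\int_0^te^{\frac{\alpha}{3}(s-t)}\,\|\widetilde F(\cdot,s)\|_H^2\,ds .$$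
   Context: $\Omega\subset\mathbb R^2$ is a bounded domain. $(\cdot,\cdot)$ and $\|\cdot\|$ are the $L^2(\Omega)$ inner product and norm. For a positive weight $\kappa$, $\|g\|_\kappa^2=\int_\Omega\kappa|g|^2\,dx$. For a vector field $u=(u_1,u_2)$, $u^\perp=(-u_2,u_1)$. Subscript $t$ denotes time derivative. $\epsilon,\beta>0$ are constants. $H$ is a function with $0<H_*\le H\le H^*<\infty$ a.e. $f$ is a function with $|f|\le1$. The damping coefficient $C$ is a function with $0<C_*\le C\le C^*<\infty$. $\widetilde F$ is a forcing with $\widetilde F(\cdot,t)\in L^2(\Omega)$ (in the paper $\widetilde F=F_t$, the time derivative of the forcing $F$ in the momentum equation). $V=H(\mathrm{div};\Omega)$, with $u\cdot n=0$ on any boundary. $V_h\subset V$ is a finite-dimensional Raviart–Thomas, Brezzi–Douglas–Marini or Brezzi–Douglas–Fortin–Marini space on triangles. Helmholtz decomposition: every $u\in V_h$ is written uniquely as $u=u^D+u^S$ with $u^D,u^S\in V_h$, where $\nabla\cdot u^S=0$ and $u^D$ is orthogonal, in the inner product $(\frac1H\cdot,\cdot)$, to all divergence-free elements of $V_h$. $C_P>0$ is a constant for the generalized Poincaré–Friedrichs inequality $\|u^D\|_{1/H}\le C_P\|\nabla\cdot u^D\|_{1/H}$ for all such $u^D$ (in $V_h$, as well as for the analogous decomposition of $V$). *)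

theory Defs
  imports "HOL-Analysis.Analysis"
begin

section \<open>Square-integrable fields\<close>

text \<open>Elements of \<open>L\<^sup>2(\<Omega>)\<close> are represented by functions on the whole plane, of which only the
  values almost everywhere in \<open>\<Omega>\<close> matter. The value type is \<^typ>\<open>real\<close> for scalar fields and
  \<^typ>\<open>real ^ 2\<close> for vector fields.\<close>

definition L2 :: "(real ^ 2) set \<Rightarrow> (real ^ 2 \<Rightarrow> 'b::euclidean_space) set" where
  "L2 \<Omega> = {u \<in> borel_measurable (lebesgue_on \<Omega>). integrable (lebesgue_on \<Omega>) (\<lambda>x. (norm (u x))\<^sup>2)}"

definition L2_inner ::
    "(real ^ 2) set \<Rightarrow> (real ^ 2 \<Rightarrow> 'b::euclidean_space) \<Rightarrow> (real ^ 2 \<Rightarrow> 'b) \<Rightarrow> real" where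
  "L2_inner \<Omega> u v = (\<integral>x. u x \<bullet> v x \<partial>lebesgue_on \<Omega>)"

definition L2_norm :: "(real ^ 2) set \<Rightarrow> (real ^ 2 \<Rightarrow> 'b::euclidean_space) \<Rightarrow> real" where
  "L2_norm \<Omega> g = sqrt (L2_inner \<Omega> g g)"

definition weighted_norm ::
    "(real ^ 2) set \<Rightarrow> (real ^ 2 \<Rightarrow> real) \<Rightarrow> (real ^ 2 \<Rightarrow> 'b::euclidean_space) \<Rightarrow> real" where
  "weighted_norm \<Omega> \<kappa> g = sqrt (\<integral>x. \<kappa> x * (norm (g x))\<^sup>2 \<partial>lebesgue_on \<Omega>)"

definition perp :: "real ^ 2 \<Rightarrow> real ^ 2" where
  "perp u = vector [- (u $ 2), u $ 1]"

section \<open>Weak derivatives and \<open>H(div)\<close>\<close>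

primrec Ck :: "nat \<Rightarrow> (real ^ 2 \<Rightarrow> real) \<Rightarrow> bool" where
  "Ck 0 \<phi> \<longleftrightarrow> continuous_on UNIV \<phi>"
| "Ck (Suc k) \<phi> \<longleftrightarrow> (\<forall>x. \<phi> differentiable (at x)) \<and>
     (\<forall>v. Ck k (\<lambda>x. frechet_derivative \<phi> (at x) v))"

definition grad :: "(real ^ 2 \<Rightarrow> real) \<Rightarrow> real ^ 2 \<Rightarrow> real ^ 2" where
  "grad \<phi> x = (\<chi> i. frechet_derivative \<phi> (at x) (axis i 1))"

text \<open>The test functions \<open>C\<^sub>c\<^sup>\<infinity>(\<Omega>)\<close>, extended by zero.\<close>

definition test_functions :: "(real ^ 2) set \<Rightarrow> (real ^ 2 \<Rightarrow> real) set" where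
  "test_functions \<Omega> = {\<phi>. (\<forall>k. Ck k \<phi>) \<and> (\<exists>K. compact K \<and> K \<subseteq> \<Omega> \<and> (\<forall>x. x \<notin> K \<longrightarrow> \<phi> x = 0))}"

definition has_weak_grad ::
    "(real ^ 2) set \<Rightarrow> (real ^ 2 \<Rightarrow> real) \<Rightarrow> (real ^ 2 \<Rightarrow> real ^ 2) \<Rightarrow> bool" where
  "has_weak_grad \<Omega> w g \<longleftrightarrow>
     (\<forall>\<phi>\<in>test_functions \<Omega>. \<forall>i. L2_inner \<Omega> w (\<lambda>x. grad \<phi> x $ i) = - L2_inner \<Omega> (\<lambda>x. g x $ i) \<phi>)"

definition has_weak_div ::
    "(real ^ 2) set \<Rightarrow> (real ^ 2 \<Rightarrow> real ^ 2) \<Rightarrow> (real ^ 2 \<Rightarrow> real) \<Rightarrow> bool" where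
  "has_weak_div \<Omega> u d \<longleftrightarrow>
     (\<forall>\<phi>\<in>test_functions \<Omega>. L2_inner \<Omega> u (grad \<phi>) = - L2_inner \<Omega> d \<phi>)"

text \<open>The weak divergence is determined only up to null sets; \<open>wdiv \<Omega> u\<close> is a representative,
  meaningful for \<open>u \<in> Hdiv \<Omega>\<close>.\<close>

definition wdiv :: "(real ^ 2) set \<Rightarrow> (real ^ 2 \<Rightarrow> real ^ 2) \<Rightarrow> real ^ 2 \<Rightarrow> real" where
  "wdiv \<Omega> u = (SOME d. d \<in> L2 \<Omega> \<and> has_weak_div \<Omega> u d)"

definition Hdiv :: "(real ^ 2) set \<Rightarrow> (real ^ 2 \<Rightarrow> real ^ 2) set" where
  "Hdiv \<Omega> = {u \<in> L2 \<Omega>. \<exists>d \<in> L2 \<Omega>. has_weak_div \<Omega> u d}"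

definition Hdiv_norm :: "(real ^ 2) set \<Rightarrow> (real ^ 2 \<Rightarrow> real ^ 2) \<Rightarrow> real" where
  "Hdiv_norm \<Omega> u = sqrt ((L2_norm \<Omega> u)\<^sup>2 + (L2_norm \<Omega> (wdiv \<Omega> u))\<^sup>2)"

text \<open>\<open>u \<cdot> n = 0\<close> on the boundary in the usual sense of \<open>H(div)\<close>: the normal trace, the functional
  \<open>w \<mapsto> (u, \<nabla>w) + (\<nabla>\<cdot>u, w)\<close> on \<open>H\<^sup>1(\<Omega>)\<close>, vanishes.\<close>

definition zero_normal_trace :: "(real ^ 2) set \<Rightarrow> (real ^ 2 \<Rightarrow> real ^ 2) \<Rightarrow> bool" where
  "zero_normal_trace \<Omega> u \<longleftrightarrow>
     (\<forall>w\<in>L2 \<Omega>. \<forall>g\<in>L2 \<Omega>. has_weak_grad \<Omega> w g \<longrightarrow> L2_inner \<Omega> u g + L2_inner \<Omega> (wdiv \<Omega> u) w = 0)"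

definition Hdiv0 :: "(real ^ 2) set \<Rightarrow> (real ^ 2 \<Rightarrow> real ^ 2) set" where
  "Hdiv0 \<Omega> = {u \<in> Hdiv \<Omega>. zero_normal_trace \<Omega> u}"

section \<open>Mixed finite element spaces on triangles\<close>

text \<open>A conforming mesh of \<open>\<Omega>\<close>. Asking that the open triangles lie in \<open>\<Omega>\<close> makes \<open>\<Omega>\<close> agree with the
  union of the mesh up to triangle edges.\<close>

definition triangle_mesh :: "(real ^ 2) set \<Rightarrow> (real ^ 2) set set \<Rightarrow> bool" where
  "triangle_mesh \<Omega> \<T> \<longleftrightarrow> triangulation \<T> \<and> (\<forall>T\<in>\<T>. 2 simplex T \<and> interior T \<subseteq> \<Omega>) \<and> \<Union>\<T> = closure \<Omega>"

text \<open>Polynomial functions of total degree at most \<open>k\<close>, scalar and vector valued.\<close>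

definition poly_fun :: "nat \<Rightarrow> (real ^ 2 \<Rightarrow> real) set" where
  "poly_fun k = {p. \<exists>c. \<forall>x. p x = (\<Sum>i\<le>k. \<Sum>j\<le>k - i. c i j * (x $ 1) ^ i * (x $ 2) ^ j)}"

definition poly_field :: "nat \<Rightarrow> (real ^ 2 \<Rightarrow> real ^ 2) set" where
  "poly_field k = {p. \<forall>i. (\<lambda>x. p x $ i) \<in> poly_fun k}"

text \<open>The local spaces on a triangle \<open>T\<close>. In \<open>BDFM\<close>, the normal components on the edges
  lose one degree; quantifying over all vectors \<open>n\<close> normal to \<open>e\<close> avoids choosing
  an orientation and a scaling.\<close>

definition RT :: "nat \<Rightarrow> (real ^ 2) set \<Rightarrow> (real ^ 2 \<Rightarrow> real ^ 2) set" where
  "RT k T = {\<lambda>x. p x + q x *\<^sub>R x | p q. p \<in> poly_field k \<and> q \<in> poly_fun k}"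

definition BDM :: "nat \<Rightarrow> (real ^ 2) set \<Rightarrow> (real ^ 2 \<Rightarrow> real ^ 2) set" where
  "BDM k T = poly_field k"

definition BDFM :: "nat \<Rightarrow> (real ^ 2) set \<Rightarrow> (real ^ 2 \<Rightarrow> real ^ 2) set" where
  "BDFM k T = {p \<in> poly_field k. \<forall>e n. e edge_of T \<and> (\<forall>x\<in>e. \<forall>y\<in>e. n \<bullet> (x - y) = 0) \<longrightarrow>
     (\<exists>q\<in>poly_fun (k - 1). \<forall>x\<in>e. p x \<bullet> n = q x)}"

text \<open>Normal continuity across the interior edges is contained in \<open>v \<in> Hdiv0 \<Omega>\<close>.\<close>

definition piecewise_space ::
    "(real ^ 2) set \<Rightarrow> (real ^ 2) set set \<Rightarrow> ((real ^ 2) set \<Rightarrow> (real ^ 2 \<Rightarrow> real ^ 2) set)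
      \<Rightarrow> (real ^ 2 \<Rightarrow> real ^ 2) set" where
  "piecewise_space \<Omega> \<T> P = {v \<in> Hdiv0 \<Omega>. \<forall>T\<in>\<T>. \<exists>p\<in>P T. AE x in lebesgue_on T. v x = p x}"

definition mixed_fe_space :: "(real ^ 2) set \<Rightarrow> (real ^ 2 \<Rightarrow> real ^ 2) set \<Rightarrow> bool" where
  "mixed_fe_space \<Omega> W \<longleftrightarrow> (\<exists>\<T>. triangle_mesh \<Omega> \<T> \<and>
     ((\<exists>k. W = piecewise_space \<Omega> \<T> (RT k)) \<or>
      (\<exists>k\<ge>1. W = piecewise_space \<Omega> \<T> (BDM k)) \<or>
      (\<exists>k\<ge>1. W = piecewise_space \<Omega> \<T> (BDFM k))))"

section \<open>Helmholtz decomposition\<close>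

definition div_free :: "(real ^ 2) set \<Rightarrow> (real ^ 2 \<Rightarrow> real ^ 2) \<Rightarrow> bool" where
  "div_free \<Omega> w \<longleftrightarrow> (AE x in lebesgue_on \<Omega>. wdiv \<Omega> w x = 0)"

definition helmholtz_decomposition ::
    "(real ^ 2) set \<Rightarrow> (real ^ 2 \<Rightarrow> real) \<Rightarrow> (real ^ 2 \<Rightarrow> real ^ 2) set
      \<Rightarrow> (real ^ 2 \<Rightarrow> real ^ 2) \<Rightarrow> (real ^ 2 \<Rightarrow> real ^ 2) \<Rightarrow> (real ^ 2 \<Rightarrow> real ^ 2) \<Rightarrow> bool" where
  "helmholtz_decomposition \<Omega> H W u uD uS \<longleftrightarrow>
     uD \<in> W \<and> uS \<in> W \<and> (AE x in lebesgue_on \<Omega>. u x = uD x + uS x) \<and> div_free \<Omega> uS \<and>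
     (\<forall>w\<in>W. div_free \<Omega> w \<longrightarrow> L2_inner \<Omega> (\<lambda>x. (1 / H x) *\<^sub>R uD x) w = 0)"

definition poincare_friedrichs ::
    "(real ^ 2) set \<Rightarrow> (real ^ 2 \<Rightarrow> real) \<Rightarrow> (real ^ 2 \<Rightarrow> real ^ 2) set \<Rightarrow> real \<Rightarrow> bool" where
  "poincare_friedrichs \<Omega> H W CP \<longleftrightarrow>
     (\<forall>u\<in>W. \<forall>uD uS. helmholtz_decomposition \<Omega> H W u uD uS \<longrightarrow>
        weighted_norm \<Omega> (\<lambda>x. 1 / H x) uD \<le> CP * weighted_norm \<Omega> (\<lambda>x. 1 / H x) (wdiv \<Omega> uD))"

section \<open>Curves in a finite element space\<close>

text \<open>\<open>u'\<close> is the time derivative at \<open>t \<ge> 0\<close> of the curve \<open>u\<close> in \<open>W \<subseteq> H(div)\<close> (one-sided at \<open>0\<close>),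
  with respect to the norm of \<open>H(div)\<close>. On a finite-dimensional \<open>W\<close> any other norm gives the
  same derivative, so this is componentwise differentiability in a basis of \<open>W\<close>.\<close>

definition has_time_derivative ::
    "(real ^ 2) set \<Rightarrow> (real ^ 2 \<Rightarrow> real ^ 2) set \<Rightarrow> (real \<Rightarrow> real ^ 2 \<Rightarrow> real ^ 2)
      \<Rightarrow> (real ^ 2 \<Rightarrow> real ^ 2) \<Rightarrow> real \<Rightarrow> bool" where
  "has_time_derivative \<Omega> W u u' t \<longleftrightarrow> u' \<in> W \<and>
     ((\<lambda>s. Hdiv_norm \<Omega> (\<lambda>x. (1 / (s - t)) *\<^sub>R (u s x - u t x) - u' x)) \<longlongrightarrow> 0) (at t within {0..})"

definition energy ::
    "(real ^ 2) set \<Rightarrow> (real ^ 2 \<Rightarrow> real) \<Rightarrow> real \<Rightarrow> real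
      \<Rightarrow> (real ^ 2 \<Rightarrow> real ^ 2) \<Rightarrow> (real ^ 2 \<Rightarrow> real ^ 2) \<Rightarrow> real" where
  "energy \<Omega> H \<beta> \<epsilon> u ut =
     1 / 2 * (weighted_norm \<Omega> (\<lambda>x. 1 / H x) ut)\<^sup>2 + \<beta> / (2 * \<epsilon>\<^sup>2) * (L2_norm \<Omega> (wdiv \<Omega> u))\<^sup>2"

end

theory Submission
  imports Defs
begin

text \<open>
  The energy \<open>E\<close> is drained only through the velocity: testing the equation with \<open>u\<^sub>t\<close>, where the
  rotation term drops out, gives \<open>E' = - (C/H u\<^sub>t, u\<^sub>t) + (F, u\<^sub>t)\<close>, which does not see the potential
  part \<open>\<parallel>\<nabla>\<cdot>u\<parallel>\<^sup>2\<close>. Testing with the component \<open>u\<^sup>D\<close> of the Helmholtz decomposition does see it, since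
  \<open>\<nabla>\<cdot>u\<^sup>D = \<nabla>\<cdot>u\<close>, and the Poincare-Friedrichs inequality bounds \<open>u\<^sup>D\<close> itself by \<open>\<parallel>\<nabla>\<cdot>u\<parallel>\<close>. So one follows
  the modified energy \<open>G = E + \<alpha>/3 (1/H u\<^sub>t, u\<^sup>D)\<close>. Its derivative contains one further term,
  \<open>(1/H u\<^sub>t, u\<^sub>t\<^sup>D)\<close>, which is at most \<open>(1/H u\<^sub>t, u\<^sub>t)\<close> and is absorbed by the damping.

  Put \<open>X = \<parallel>u\<^sub>t\<parallel>\<close> in the weight \<open>1/H\<close>, \<open>Y = \<surd>\<beta>/\<epsilon> \<parallel>\<nabla>\<cdot>u\<parallel>\<close>, \<open>c = C\<^sub>P \<epsilon>/\<surd>(\<beta> H\<^sub>*)\<close> and \<open>m = c (1/\<epsilon> + C\<^sup>*)\<close>, so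
  that \<open>E = (X\<^sup>2 + Y\<^sup>2)/2\<close>, the weighted norm of \<open>u\<^sup>D\<close> is at most \<open>c Y\<close>, and rotation and damping
  tested with \<open>u\<^sup>D\<close> contribute at most \<open>m X Y\<close>. The condition \<open>\<alpha> \<le> \<alpha>\<^sub>1\<close> says \<open>\<alpha> c \<le> 1/2\<close>, which
  keeps \<open>G\<close> within \<open>E/6\<close> of \<open>E\<close>; the condition \<open>\<alpha> \<le> \<alpha>\<^sub>2\<close> says \<open>\<alpha> (3 + m\<^sup>2)/2 \<le> C\<^sub>*\<close>, which leaves
  enough damping to pay for the cross terms. Then \<open>G' \<le> - \<alpha>/3 G + 5/(12 \<alpha>) \<parallel>F\<parallel>\<^sup>2\<close>, the difference
  controlled by a nonnegative quadratic form in \<open>X\<close> and \<open>Y\<close> (lemma \<open>energy_decay_algebra\<close>), and Gronwall's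
  lemma (\<open>damped_Gronwall\<close>) together with \<open>5/6 E \<le> G \<le> 7/6 E\<close> gives the bound with \<open>7/5 \<le> 3\<close>
  in front of \<open>E(0)\<close> and \<open>6/5 \<cdot> 5/12 = 1/2 \<le> K\<close> in front of the integral. The weight \<open>\<alpha>/3\<close> in \<open>G\<close> is a
  compromise: a larger one spoils the comparison of \<open>G\<close> with \<open>E\<close> and hence the two constants, and
  too small a one leaves less decay of \<open>Y\<close> than the rate \<open>\<alpha>/3\<close> demands.

  What remains is to have \<open>u\<^sup>D\<close> at all and to differentiate \<open>(1/H u\<^sub>t, u\<^sup>D)\<close> in time. Modulo null
  sets the finite element space has finite dimension (\<open>mixed_fe_space_finite_dim\<close>), so a
  Gram-Schmidt argument for the semidefinite form \<open>(1/H \<cdot>, \<cdot>)\<close> writes the projection onto its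
  divergence-free part with a finite list of fields (\<open>finite_dim_orthogonal_expansion\<close>); the
  cross term is then a finite combination of products of scalar functions of time. All of this
  needs the weak divergence to be linear, that is, to be unique almost everywhere. This is the
  fundamental lemma of the calculus of variations (\<open>orthogonal_to_test_functions_imp_AE_zero\<close>),
  proved with smooth bumps that increase to the indicator functions of boxes.
\<close>

section \<open>Square-integrable fields\<close>

lemma L2_integrable_inner:
  assumes "u \<in> L2 \<Omega>" "v \<in> L2 \<Omega>"
  shows "integrable (lebesgue_on \<Omega>) (\<lambda>x. u x \<bullet> v x)"
proof (rule Bochner_Integration.integrable_bound)
  show "integrable (lebesgue_on \<Omega>) (\<lambda>x. (norm (u x))\<^sup>2 + (norm (v x))\<^sup>2)"
    using assms by (auto simp: L2_def)
  show "(\<lambda>x. u x \<bullet> v x) \<in> borel_measurable (lebesgue_on \<Omega>)"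
    using assms by (auto simp: L2_def)
  have "\<bar>u x \<bullet> v x\<bar> \<le> (norm (u x))\<^sup>2 + (norm (v x))\<^sup>2" for x
  proof -
    have "\<bar>u x \<bullet> v x\<bar> \<le> norm (u x) * norm (v x)"
      by (rule Cauchy_Schwarz_ineq2)
    also have "\<dots> \<le> (norm (u x))\<^sup>2 + (norm (v x))\<^sup>2"
      using sum_squares_bound[of "norm (u x)" "norm (v x)"]
        mult_nonneg_nonneg[OF norm_ge_zero norm_ge_zero, of "u x" "v x"] by linarith
    finally show ?thesis .
  qed
  then show "AE x in lebesgue_on \<Omega>. norm (u x \<bullet> v x) \<le> norm ((norm (u x))\<^sup>2 + (norm (v x))\<^sup>2)"
    by (auto intro!: AE_I2)
qed

lemma L2_add:
  assumes "u \<in> L2 \<Omega>" "v \<in> L2 \<Omega>"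
  shows "(\<lambda>x. u x + v x) \<in> L2 \<Omega>"
proof -
  have "integrable (lebesgue_on \<Omega>) (\<lambda>x. (norm (u x))\<^sup>2 + (norm (v x))\<^sup>2 + 2 * (u x \<bullet> v x))"
    using assms L2_integrable_inner[OF assms] by (auto simp: L2_def)
  moreover have "(norm (u x + v x))\<^sup>2 = (norm (u x))\<^sup>2 + (norm (v x))\<^sup>2 + 2 * (u x \<bullet> v x)" for x
    by (simp add: power2_norm_eq_inner inner_add_left inner_add_right inner_commute)
  ultimately show ?thesis
    using assms by (auto simp: L2_def)
qed

lemma L2_bounded_multiple:
  assumes "u \<in> L2 \<Omega>" "k \<in> borel_measurable (lebesgue_on \<Omega>)"
    and k: "AE x in lebesgue_on \<Omega>. \<bar>k x\<bar> \<le> M"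
  shows "(\<lambda>x. k x *\<^sub>R u x) \<in> L2 \<Omega>"
proof -
  have "integrable (lebesgue_on \<Omega>) (\<lambda>x. (norm (k x *\<^sub>R u x))\<^sup>2)"
  proof (rule Bochner_Integration.integrable_bound)
    show "integrable (lebesgue_on \<Omega>) (\<lambda>x. M\<^sup>2 * (norm (u x))\<^sup>2)"
      using assms by (auto simp: L2_def)
    show "(\<lambda>x. (norm (k x *\<^sub>R u x))\<^sup>2) \<in> borel_measurable (lebesgue_on \<Omega>)"
      using assms by (auto simp: L2_def)
    show "AE x in lebesgue_on \<Omega>. norm ((norm (k x *\<^sub>R u x))\<^sup>2) \<le> norm (M\<^sup>2 * (norm (u x))\<^sup>2)"
      using k
    proof eventually_elim
      case (elim x)
      then have "(k x)\<^sup>2 \<le> M\<^sup>2"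
        by (metis abs_ge_zero power2_abs power_mono)
      then show ?case
        by (simp add: power_mult_distrib mult_right_mono)
    qed
  qed
  then show ?thesis
    using assms by (auto simp: L2_def)
qed

lemma L2_scaleR: "u \<in> L2 \<Omega> \<Longrightarrow> (\<lambda>x. c *\<^sub>R u x) \<in> L2 \<Omega>"
  by (rule L2_bounded_multiple[where M = "\<bar>c\<bar>"]) auto

lemma L2_zero: "(\<lambda>x. 0) \<in> L2 \<Omega>"
  by (simp add: L2_def)

lemma L2_inner_commute: "L2_inner \<Omega> u v = L2_inner \<Omega> v u"
  by (simp add: L2_inner_def inner_commute)

lemma L2_inner_add_left:
  assumes "u \<in> L2 \<Omega>" "v \<in> L2 \<Omega>" "w \<in> L2 \<Omega>"
  shows "L2_inner \<Omega> (\<lambda>x. u x + v x) w = L2_inner \<Omega> u w + L2_inner \<Omega> v w"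
  by (simp add: L2_inner_def inner_add_left L2_integrable_inner assms)

lemma L2_inner_scaleR_left: "L2_inner \<Omega> (\<lambda>x. c *\<^sub>R u x) w = c * L2_inner \<Omega> u w"
  by (simp add: L2_inner_def)

lemma L2_inner_nonneg: "0 \<le> L2_inner \<Omega> u u"
  by (simp add: L2_inner_def)

lemma L2_inner_cong_AE:
  assumes "AE x in lebesgue_on \<Omega>. u x = u' x" "AE x in lebesgue_on \<Omega>. v x = v' x"
    and "u \<in> L2 \<Omega>" "u' \<in> L2 \<Omega>" "v \<in> L2 \<Omega>" "v' \<in> L2 \<Omega>"
  shows "L2_inner \<Omega> u v = L2_inner \<Omega> u' v'"
  unfolding L2_inner_def
proof (rule integral_cong_AE)
  show "AE x in lebesgue_on \<Omega>. u x \<bullet> v x = u' x \<bullet> v' x"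
    using assms(1,2) by eventually_elim auto
qed (use assms in \<open>auto simp: L2_def\<close>)

lemma L2_integrable:
  assumes "u \<in> L2 \<Omega>" "bounded \<Omega>" "open \<Omega>"
  shows "integrable (lebesgue_on \<Omega>) u"
proof -
  have fin: "finite_measure (lebesgue_on \<Omega>)"
    using assms by (intro finite_measure_lebesgue_on) (auto intro: bounded_set_imp_lmeasurable)
  show ?thesis
  proof (rule Bochner_Integration.integrable_bound)
    show "integrable (lebesgue_on \<Omega>) (\<lambda>x. 1 + (norm (u x))\<^sup>2)"
      using assms fin by (auto simp: L2_def finite_measure.integrable_const)
    show "u \<in> borel_measurable (lebesgue_on \<Omega>)"
      using assms by (auto simp: L2_def)
    have "norm (u x) \<le> 1 + (norm (u x))\<^sup>2" for x
      using sum_squares_bound[of "norm (u x)" 1] by (simp; smt (verit) norm_ge_zero)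
    then show "AE x in lebesgue_on \<Omega>. norm (u x) \<le> norm (1 + (norm (u x))\<^sup>2)"
      by (auto intro!: AE_I2)
  qed
qed

lemma bounded_imp_L2:
  assumes "bounded \<Omega>" "open \<Omega>" "u \<in> borel_measurable (lebesgue_on \<Omega>)" "\<And>x. norm (u x) \<le> M"
  shows "u \<in> L2 \<Omega>"
proof -
  have fin: "finite_measure (lebesgue_on \<Omega>)"
    using assms by (intro finite_measure_lebesgue_on) (auto intro: bounded_set_imp_lmeasurable)
  have "integrable (lebesgue_on \<Omega>) (\<lambda>x. (norm (u x))\<^sup>2)"
    using assms fin
    by (intro finite_measure.integrable_const_bound[where B = "M\<^sup>2"]) (auto intro!: AE_I2 power_mono)
  then show ?thesis
    using assms by (auto simp: L2_def)
qed

section \<open>Smooth bumps and the fundamental lemma of the calculus of variations\<close>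

text \<open>The functions \<open>t\<^sup>-\<^sup>n exp (-l/t)\<close>, extended by zero to \<open>t \<le> 0\<close>. All derivatives of the standard flat
  function \<open>n = 0\<close> are combinations of members of the family. As \<open>l\<close> decreases to \<open>0\<close>, the function
  with \<open>n = 0\<close> increases to the indicator function of the positive half-line.\<close>

definition flat_exp :: "nat \<Rightarrow> real \<Rightarrow> real \<Rightarrow> real" where
  "flat_exp n l t = (if t \<le> 0 then 0 else exp (- l / t) / t ^ n)"

lemma flat_exp_tendsto_0:
  assumes "l > 0"
  shows "(flat_exp n l \<longlongrightarrow> 0) (at 0)"
proof -
  have right: "(flat_exp n l \<longlongrightarrow> 0) (at_right 0)"
  proof -
    have "((\<lambda>y. (1 / l) ^ n * ((l * y) ^ n / exp (l * y))) \<longlongrightarrow> (1 / l) ^ n * 0) at_top"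
      by (intro tendsto_mult tendsto_const filterlim_compose[OF tendsto_power_div_exp_0]
          filterlim_tendsto_pos_mult_at_top[OF tendsto_const] assms filterlim_ident)
    then have "((\<lambda>t. (1 / l) ^ n * ((l * inverse t) ^ n / exp (l * inverse t))) \<longlongrightarrow> 0) (at_right 0)"
      using filterlim_compose[OF _ filterlim_inverse_at_top_right] by fastforce
    moreover have "\<forall>\<^sub>F t in at_right 0.
        (1 / l) ^ n * ((l * inverse t) ^ n / exp (l * inverse t)) = flat_exp n l t"
      using assms
      by (auto simp: eventually_at_filter flat_exp_def field_simps exp_minus power_mult_distrib)
    ultimately show ?thesis
      by (rule Lim_transform_eventually)
  qed
  have "\<forall>\<^sub>F t in at_left 0. 0 = flat_exp n l t"
    by (auto simp: eventually_at_filter flat_exp_def)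
  then have "(flat_exp n l \<longlongrightarrow> 0) (at_left 0)"
    by (rule Lim_transform_eventually[OF tendsto_const])
  with right show ?thesis
    by (simp add: filterlim_at_split)
qed

lemma flat_exp_has_derivative:
  assumes "l > 0"
  shows "(flat_exp n l has_real_derivative - real n * flat_exp (n + 1) l t + l * flat_exp (n + 2) l t) (at t)"
proof -
  consider "t < 0" | "t = 0" | "t > 0" by linarith
  then show ?thesis
  proof cases
    case 1
    have "((\<lambda>t. 0) has_real_derivative 0) (at t)"
      by simp
    then have "(flat_exp n l has_real_derivative 0) (at t)"
      by (rule DERIV_cong_ev[THEN iffD1, rotated -1])
        (use 1 in \<open>auto simp: flat_exp_def intro!: eventually_mono[OF eventually_nhds_in_open[of "{..<0}"]]\<close>)
    then show ?thesis
      using 1 by (simp add: flat_exp_def)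
  next
    case 2
    have "\<forall>\<^sub>F s in at 0. flat_exp (n + 1) l s = (flat_exp n l (0 + s) - flat_exp n l 0) / s"
      by (auto simp: eventually_at_filter flat_exp_def)
    then have "((\<lambda>s. (flat_exp n l (0 + s) - flat_exp n l 0) / s) \<longlongrightarrow> 0) (at 0)"
      by (rule Lim_transform_eventually[OF flat_exp_tendsto_0[OF assms]])
    then show ?thesis
      using 2 by (simp add: DERIV_def flat_exp_def)
  next
    case 3
    have "((\<lambda>t. exp (- l / t) / t ^ n) has_real_derivative
        - real n * (exp (- l / t) / t ^ (n + 1)) + l * (exp (- l / t) / t ^ (n + 2))) (at t)"
    proof (cases n)
      case 0
      show ?thesis
        using 3 unfolding 0
        by (auto intro!: derivative_eq_intros simp: field_simps power2_eq_square)
    next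
      case (Suc m)
      show ?thesis
        using 3 unfolding Suc
        by (auto intro!: derivative_eq_intros simp: divide_simps)
          (auto simp: algebra_simps power_eq_if)
    qed
    then have "(flat_exp n l has_real_derivative
        - real n * (exp (- l / t) / t ^ (n + 1)) + l * (exp (- l / t) / t ^ (n + 2))) (at t)"
      by (rule DERIV_cong_ev[THEN iffD1, rotated -1])
        (use 3 in \<open>auto simp: flat_exp_def intro!: eventually_mono[OF eventually_nhds_in_open[of "{0<..}"]]\<close>)
    then show ?thesis
      using 3 by (simp add: flat_exp_def)
  qed
qed

text \<open>An algebra of functions on the plane that contains its own directional derivatives. Membership
  therefore implies smoothness by an induction on the order of differentiation.\<close>

inductive_set flat_exp_algebra :: "(real ^ 2 \<Rightarrow> real) set" where
  const: "(\<lambda>x. c) \<in> flat_exp_algebra"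
| atom: "l > 0 \<Longrightarrow> (\<lambda>x. flat_exp n l (s * x $ i + c)) \<in> flat_exp_algebra"
| add: "p \<in> flat_exp_algebra \<Longrightarrow> q \<in> flat_exp_algebra \<Longrightarrow> (\<lambda>x. p x + q x) \<in> flat_exp_algebra"
| mult: "p \<in> flat_exp_algebra \<Longrightarrow> q \<in> flat_exp_algebra \<Longrightarrow> (\<lambda>x. p x * q x) \<in> flat_exp_algebra"

lemma flat_exp_algebra_derivative:
  assumes "p \<in> flat_exp_algebra"
  shows "\<exists>p'. (\<forall>x. (p has_derivative p' x) (at x)) \<and> (\<forall>v. (\<lambda>x. p' x v) \<in> flat_exp_algebra)"
  using assms
proof induction
  case (const c)
  show ?case
    by (intro exI[of _ "\<lambda>x v. 0"]) (auto intro: flat_exp_algebra.const)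
next
  case (atom l n s i c)
  let ?r = "\<lambda>x::real^2. s * x $ i + c"
  let ?d = "\<lambda>x. - real n * flat_exp (n + 1) l (?r x) + l * flat_exp (n + 2) l (?r x)"
  have "((\<lambda>x. flat_exp n l (?r x)) has_derivative (\<lambda>v. ?d x * (s * v $ i))) (at x)" for x
  proof -
    have r: "(?r has_derivative (\<lambda>v. s * v $ i)) (at x)"
      by (auto intro!: derivative_eq_intros bounded_linear.has_derivative[OF bounded_linear_vec_nth])
    have "(flat_exp n l has_derivative (\<lambda>h. ?d x * h)) (at (?r x))"
      using flat_exp_has_derivative[OF atom, of n "?r x"] by (simp add: has_field_derivative_def)
    from has_derivative_compose[OF r this] show ?thesis .
  qed
  moreover have "(\<lambda>x. ?d x * (s * v $ i)) \<in> flat_exp_algebra" for v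
    by (intro flat_exp_algebra.intros atom)
  ultimately show ?case
    by (intro exI[of _ "\<lambda>x v. ?d x * (s * v $ i)"]) blast
next
  case (add p q)
  then obtain p' q' where
    "\<And>x. (p has_derivative p' x) (at x)" "\<And>v. (\<lambda>x. p' x v) \<in> flat_exp_algebra"
    "\<And>x. (q has_derivative q' x) (at x)" "\<And>v. (\<lambda>x. q' x v) \<in> flat_exp_algebra"
    by blast
  then show ?case
    by (intro exI[of _ "\<lambda>x v. p' x v + q' x v"])
      (auto intro!: has_derivative_add flat_exp_algebra.add)
next
  case (mult p q)
  then obtain p' q' where *:
    "\<And>x. (p has_derivative p' x) (at x)" "\<And>v. (\<lambda>x. p' x v) \<in> flat_exp_algebra"
    "\<And>x. (q has_derivative q' x) (at x)" "\<And>v. (\<lambda>x. q' x v) \<in> flat_exp_algebra"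
    by blast
  have "((\<lambda>x. p x * q x) has_derivative (\<lambda>v. p x * q' x v + p' x v * q x)) (at x)" for x
    by (rule has_derivative_mult) (use * in auto)
  then show ?case
    using * mult.hyps
    by (intro exI[of _ "\<lambda>x v. p x * q' x v + p' x v * q x"])
      (auto intro!: flat_exp_algebra.add flat_exp_algebra.mult)
qed

lemma flat_exp_algebra_Ck: "p \<in> flat_exp_algebra \<Longrightarrow> Ck k p"
proof (induction k arbitrary: p)
  case 0
  then obtain p' where "\<And>x. (p has_derivative p' x) (at x)"
    using flat_exp_algebra_derivative by blast
  then show ?case
    by (auto intro!: continuous_at_imp_continuous_on has_derivative_continuous)
next
  case (Suc k)
  then obtain p' where p': "\<And>x. (p has_derivative p' x) (at x)" "\<And>v. (\<lambda>x. p' x v) \<in> flat_exp_algebra"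
    using flat_exp_algebra_derivative by blast
  then have "frechet_derivative p (at x) = p' x" for x
    by (metis frechet_derivative_at)
  with p' show ?case
    by (auto simp: differentiable_def intro!: Suc.IH)
qed

text \<open>The coefficients \<open>1\<close> and \<open>-1\<close> and the sums are written out so that the four factors match the
  atoms of the algebra.\<close>

definition box_bump :: "real \<Rightarrow> real ^ 2 \<Rightarrow> real ^ 2 \<Rightarrow> real ^ 2 \<Rightarrow> real" where
  "box_bump l a b x =
     flat_exp 0 l (1 * x $ 1 + (- a $ 1)) * flat_exp 0 l (1 * x $ 2 + (- a $ 2)) *
     (flat_exp 0 l ((-1) * x $ 1 + b $ 1) * flat_exp 0 l ((-1) * x $ 2 + b $ 2))"

lemma box_bump_algebra:
  assumes "l > 0"
  shows "box_bump l a b \<in> flat_exp_algebra"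
  unfolding box_bump_def[abs_def]
  by (intro flat_exp_algebra.intros assms)

lemma flat_exp_0_bounds: "l > 0 \<Longrightarrow> 0 \<le> flat_exp 0 l t \<and> flat_exp 0 l t \<le> 1"
  by (auto simp: flat_exp_def)

lemma box_bump_bounds:
  assumes "l > 0"
  shows "0 \<le> box_bump l a b x \<and> box_bump l a b x \<le> 1"
  unfolding box_bump_def using flat_exp_0_bounds[OF assms]
  by (auto intro!: mult_nonneg_nonneg mult_le_one)

lemma box_bump_outside: "x \<notin> box a b \<Longrightarrow> box_bump l a b x = 0"
  by (auto simp: box_bump_def flat_exp_def mem_box_cart forall_2)

lemma flat_exp_0_tendsto: "((\<lambda>k. flat_exp 0 (1 / real (Suc k)) t) \<longlongrightarrow> (if t \<le> 0 then 0 else 1)) sequentially"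
proof (cases "t \<le> 0")
  case False
  have "(\<lambda>k. exp (- (1 / real (Suc k)) / t)) \<longlonglongrightarrow> exp (- 0 / t)"
    using False
    by (intro tendsto_intros LIMSEQ_Suc[OF lim_1_over_n]) auto
  with False show ?thesis
    by (simp add: flat_exp_def)
qed (simp add: flat_exp_def)

lemma box_bump_tendsto:
  "(\<lambda>k. box_bump (1 / real (Suc k)) a b x) \<longlonglongrightarrow> indicator (box a b) x"
proof -
  have "indicator (box a b) x =
     (if 1 * x $ 1 + (- a $ 1) \<le> 0 then 0 else 1) * (if 1 * x $ 2 + (- a $ 2) \<le> 0 then 0 else 1) *
     ((if (-1) * x $ 1 + b $ 1 \<le> 0 then 0 else 1) * (if (-1) * x $ 2 + b $ 2 \<le> 0 then 0 else (1::real)))"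
    by (auto simp: indicator_def mem_box_cart forall_2)
  then show ?thesis
    unfolding box_bump_def by (simp only:) (intro tendsto_mult flat_exp_0_tendsto)
qed

text \<open>Boxes form an intersection-stable generator of the Borel sets, so a Dynkin argument extends the
  vanishing of the integral from boxes, and the whole space, to all Borel sets.\<close>

lemma integral_zero_on_boxes_imp_AE_zero:
  fixes g :: "'a::euclidean_space \<Rightarrow> real"
  assumes g: "integrable lborel g" and zero: "integral\<^sup>L lborel g = 0"
    and boxes: "\<And>a b. (\<integral>x. indicator (box a b) x * g x \<partial>lborel) = 0"
  shows "AE x in lborel. g x = 0"
proof (rule density_unique_real[OF g integrable_zero])
  have set_int: "set_integrable lborel A g" if "A \<in> sets lborel" for A
    unfolding set_integrable_def by (rule integrable_mult_indicator[OF that g])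
  have boxes_stable: "Int_stable (range (\<lambda>(a, b :: 'a). box a b))"
    "range (\<lambda>(a, b :: 'a). box a b) \<subseteq> Pow UNIV"
    by (auto simp: Int_stable_def box_Int_box)
  fix A :: "'a set"
  assume "A \<in> sets lborel"
  then have "A \<in> sigma_sets UNIV (range (\<lambda>(a, b). box a b))"
    by (simp add: borel_eq_box)
  with boxes_stable have "(LINT x:A|lborel. g x) = 0"
  proof (induction rule: sigma_sets_induct_disjoint)
    case (basic A)
    then show ?case
      using boxes by (auto simp: set_lebesgue_integral_def)
  next
    case empty
    show ?case
      by (simp add: set_lebesgue_integral_def)
  next
    case (compl A)
    then have "A \<in> sets borel"
      by (simp add: borel_eq_box)
    then have "(LINT x:A \<union> - A|lborel. g x) = (LINT x:A|lborel. g x) + (LINT x:- A|lborel. g x)"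
      by (intro set_integral_Un set_int) auto
    then show ?case
      using compl zero by (simp add: set_lebesgue_integral_def Compl_eq_Diff_UNIV)
  next
    case (union A)
    then have A: "A i \<in> sets borel" for i
      by (auto simp: borel_eq_box)
    then have "(\<Union>i. A i) \<in> sets lborel"
      by auto
    then have "(LINT x:(\<Union>i. A i)|lborel. g x) = (\<Sum>i. (LINT x:(A i)|lborel. g x))"
      using union(1) A
      by (intro lebesgue_integral_countable_add set_int) (auto simp: disjoint_family_on_def)
    then show ?case
      using union by simp
  qed
  then show "(LINT x:A|lborel. g x) = (LINT x:A|lborel. 0)"
    by simp
qed

lemma box_bump_in_test_functions:
  assumes "l > 0" "q \<in> flat_exp_algebra" "cbox a b \<subseteq> \<Omega>"
  shows "(\<lambda>x. box_bump l a b x * q x) \<in> test_functions \<Omega>"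
proof -
  have "(\<lambda>x. box_bump l a b x * q x) \<in> flat_exp_algebra"
    by (intro flat_exp_algebra.mult box_bump_algebra assms)
  moreover have "box_bump l a b x * q x = 0" if "x \<notin> cbox a b" for x
    using that box_bump_outside[of x a b l] box_subset_cbox[of a b] by auto
  ultimately show ?thesis
    using assms(3) by (auto simp: test_functions_def flat_exp_algebra_Ck intro!: exI[of _ "cbox a b"])
qed

text \<open>The product of a bump for the given box with a bump for an arbitrary second box is a test function
  on \<open>\<Omega>\<close>, wherever the second box lies. In the limit of sharp bumps, \<open>d\<close> restricted to the first box
  has integral zero over every box of the plane.\<close>

lemma orthogonal_to_test_functions_imp_AE_zero_on_box:
  assumes \<Omega>: "open \<Omega>" and d: "integrable (lebesgue_on \<Omega>) d"
    and ortho: "\<And>\<phi>. \<phi> \<in> test_functions \<Omega> \<Longrightarrow> L2_inner \<Omega> d \<phi> = 0"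
    and sub: "cbox a b \<subseteq> \<Omega>"
  shows "AE x in lebesgue. x \<in> box a b \<longrightarrow> d x = 0"
proof -
  have \<Omega>_sets: "\<Omega> \<inter> space lebesgue \<in> sets lebesgue"
    using \<Omega> by auto
  define d0 where "d0 x = indicator \<Omega> x * d x" for x
  have d0: "integrable lebesgue d0"
    using d integrable_restrict_space[OF \<Omega>_sets, of d] by (simp add: d0_def[abs_def])
  then obtain g where g: "g \<in> borel_measurable lborel" "AE x in lborel. d0 x = g x"
    using completion_ex_borel_measurable_real[of d0 lborel] by auto
  have ae: "AE x in lebesgue. d0 x = g x"
    using g(2) by (rule AE_completion)
  have g_int: "integrable lborel g"
    using d0 g(1) ae integrable_completion[OF g(1)]
    by (subst integrable_completion[OF g(1), symmetric])
      (rule integrable_cong_AE_imp[OF d0], auto intro: measurable_completion)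
  have zero: "(\<integral>x. \<phi> x * g x \<partial>lborel) = 0"
    if \<phi>: "\<phi> \<in> test_functions \<Omega>" and [measurable]: "\<phi> \<in> borel_measurable borel" for \<phi>
  proof -
    have [measurable]: "g \<in> borel_measurable lborel" by fact
    have [measurable]: "\<phi> \<in> borel_measurable lebesgue" "g \<in> borel_measurable lebesgue"
      by (auto intro: measurable_completion)
    have "(\<integral>x. \<phi> x * g x \<partial>lborel) = (\<integral>x. \<phi> x * g x \<partial>lebesgue)"
      by (rule integral_completion[symmetric]) measurable
    also have "\<dots> = (\<integral>x. \<phi> x * d0 x \<partial>lebesgue)"
      using ae d0 by (intro integral_cong_AE) auto
    also have "\<dots> = L2_inner \<Omega> d \<phi>"
      unfolding L2_inner_def by (subst integral_restrict_space[OF \<Omega>_sets])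
        (auto simp: d0_def mult_ac intro!: Bochner_Integration.integral_cong)
    finally show ?thesis
      using ortho[OF \<phi>] by simp
  qed
  have meas: "p \<in> borel_measurable borel" if "p \<in> flat_exp_algebra" for p
    using flat_exp_algebra_Ck[OF that, of 0] by (auto intro: borel_measurable_continuous_onI)
  let ?b = "\<lambda>k. box_bump (1 / real (Suc k))"
  have limit: "(\<integral>x. indicator (box a b) x * q x * g x \<partial>lborel) = 0"
    if q: "\<And>k. q' k \<in> flat_exp_algebra" "\<And>x. (\<lambda>k. q' k x) \<longlonglongrightarrow> q x"
      "\<And>k x. \<bar>q' k x\<bar> \<le> 1" and [measurable]: "q \<in> borel_measurable borel" for q :: "real^2 \<Rightarrow> real" and q'
  proof -
    have bump[measurable]: "?b k a b \<in> borel_measurable borel" for k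
      by (intro meas box_bump_algebra) simp
    have [measurable]: "q' k \<in> borel_measurable borel" for k
      by (intro meas q)
    have [measurable]: "g \<in> borel_measurable borel"
      using g(1) by simp
    have "(\<lambda>k. \<integral>x. ?b k a b x * q' k x * g x \<partial>lborel) \<longlonglongrightarrow> (\<integral>x. indicator (box a b) x * q x * g x \<partial>lborel)"
    proof (rule integral_dominated_convergence)
      show "integrable lborel (\<lambda>x. norm (g x))"
        using g_int by (rule integrable_norm)
      show "AE x in lborel. (\<lambda>k. ?b k a b x * q' k x * g x) \<longlonglongrightarrow> indicator (box a b) x * q x * g x"
        by (intro AE_I2 tendsto_mult box_bump_tendsto q tendsto_const)
      have "\<bar>?b k a b x\<bar> * \<bar>q' k x\<bar> * \<bar>g x\<bar> \<le> \<bar>g x\<bar>" for k x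
        using box_bump_bounds[of "1 / real (Suc k)" a b x] q(3)[of k x]
        by (intro mult_left_le_one_le mult_le_one) auto
      then show "AE x in lborel. norm (?b k a b x * q' k x * g x) \<le> norm (g x)" for k
        by (auto simp: abs_mult)
    qed measurable
    moreover have "(\<integral>x. ?b k a b x * q' k x * g x \<partial>lborel) = 0" for k
    proof (rule zero[OF box_bump_in_test_functions])
      show "(\<lambda>x. ?b k a b x * q' k x) \<in> borel_measurable borel"
        by measurable
    qed (use q sub in auto)
    ultimately show ?thesis
      by (simp add: LIMSEQ_const_iff)
  qed
  have "AE x in lborel. indicator (box a b) x * g x = 0"
  proof (rule integral_zero_on_boxes_imp_AE_zero)
    show "integrable lborel (\<lambda>x. indicator (box a b) x * g x)"
      using integrable_mult_indicator[OF _ g_int, of "box a b"] by simp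
    show "(\<integral>x. indicator (box a b) x * g x \<partial>lborel) = 0"
      using limit[of "\<lambda>k x. 1" "\<lambda>x. 1"] by (auto intro: flat_exp_algebra.const)
    show "(\<integral>x. indicator (box a' b') x * (indicator (box a b) x * g x) \<partial>lborel) = 0" for a' b'
    proof -
      have "\<bar>?b k a' b' x\<bar> \<le> 1" for k x
        using box_bump_bounds[of "1 / real (Suc k)" a' b' x] by simp
      then have "(\<integral>x. indicator (box a b) x * indicator (box a' b') x * g x \<partial>lborel) = 0"
        by (intro limit[of "\<lambda>k. ?b k a' b'"] box_bump_algebra box_bump_tendsto) auto
      then show ?thesis
        by (simp only: mult_ac)
    qed
  qed
  then have "AE x in lebesgue. indicator (box a b) x * g x = 0"
    by (rule AE_completion)
  with ae show ?thesis
  proof eventually_elim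
    case (elim x)
    then show ?case
      using sub box_subset_cbox[of a b] by (auto simp: d0_def split: split_indicator_asm)
  qed
qed

text \<open>An open set is a countable union of compact boxes, whose boundaries are null sets.\<close>

lemma orthogonal_to_test_functions_imp_AE_zero:
  assumes \<Omega>: "open \<Omega>" and d: "integrable (lebesgue_on \<Omega>) d"
    and ortho: "\<And>\<phi>. \<phi> \<in> test_functions \<Omega> \<Longrightarrow> L2_inner \<Omega> d \<phi> = 0"
  shows "AE x in lebesgue_on \<Omega>. d x = 0"
proof -
  obtain \<D> where \<D>: "countable \<D>" "\<D> \<subseteq> Pow \<Omega>" "\<And>X. X \<in> \<D> \<Longrightarrow> \<exists>a b. X = cbox a b"
    "\<Union>\<D> = \<Omega>"
    using open_countable_Union_open_cbox[OF \<Omega>] by metis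
  have "AE x in lebesgue. x \<in> X \<longrightarrow> d x = 0" if X\<D>: "X \<in> \<D>" for X
  proof -
    obtain a b where X: "X = cbox a b"
      using \<D>(3)[OF X\<D>] by blast
    then have "AE x in lebesgue. x \<in> box a b \<longrightarrow> d x = 0"
      using orthogonal_to_test_functions_imp_AE_zero_on_box[OF \<Omega> d ortho] \<D> X\<D> by blast
    moreover have "AE x in lebesgue. x \<notin> cbox a b - box a b"
      using negligible_frontier_interval[of a b]
      by (intro AE_not_in) (simp add: negligible_iff_null_sets)
    ultimately show ?thesis
      unfolding X by eventually_elim auto
  qed
  then have "AE x in lebesgue. \<forall>X\<in>\<D>. x \<in> X \<longrightarrow> d x = 0"
    by (subst AE_ball_countable[OF \<D>(1)]) blast
  then have "AE x in lebesgue. x \<in> \<Omega> \<longrightarrow> d x = 0"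
    by eventually_elim (use \<D>(4) in auto)
  then show ?thesis
    using \<Omega> by (subst AE_restrict_space_iff) auto
qed

section \<open>Linearity of the weak divergence\<close>

text \<open>Both \<open>\<phi>\<close> and its gradient are continuous and vanish off a compact set; for the gradient this holds
  because the complement of that set is open.\<close>

lemma test_function_facts:
  assumes "\<phi> \<in> test_functions \<Omega>" "bounded \<Omega>" "open \<Omega>"
  shows test_function_L2: "\<phi> \<in> L2 \<Omega>" and grad_test_function_L2: "grad \<phi> \<in> L2 \<Omega>"
proof -
  obtain K where K: "compact K" "K \<subseteq> \<Omega>" "\<And>x. x \<notin> K \<Longrightarrow> \<phi> x = 0"
    and Ck: "\<And>k. Ck k \<phi>"
    using assms by (auto simp: test_functions_def)
  have L2: "\<psi> \<in> L2 \<Omega>" if "continuous_on UNIV \<psi>" "\<And>x. x \<notin> K \<Longrightarrow> \<psi> x = 0"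
    for \<psi> :: "real ^ 2 \<Rightarrow> 'b::euclidean_space"
  proof -
    have "bounded (\<psi> ` K)"
      using K(1) that(1) by (intro compact_imp_bounded compact_continuous_image) (auto intro: continuous_on_subset)
    then obtain M where M: "\<And>x. x \<in> K \<Longrightarrow> norm (\<psi> x) \<le> M"
      by (auto simp: bounded_iff)
    have "norm (\<psi> x) \<le> max M 0" for x
      using M[of x] that(2)[of x] by (cases "x \<in> K") auto
    moreover have "\<psi> \<in> borel_measurable (lebesgue_on \<Omega>)"
      using that(1) by (intro measurable_restrict_space1 measurable_completion)
        (auto intro: borel_measurable_continuous_onI)
    ultimately show ?thesis
      using assms by (intro bounded_imp_L2)
  qed
  show "\<phi> \<in> L2 \<Omega>"
    using Ck[of 0] K by (intro L2) auto
  show "grad \<phi> \<in> L2 \<Omega>"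
  proof (rule L2)
    have "continuous_on UNIV (\<lambda>x. frechet_derivative \<phi> (at x) (axis i 1))" for i
      using Ck[of "Suc 0"] by simp
    then show "continuous_on UNIV (grad \<phi>)"
      unfolding grad_def[abs_def] by (intro continuous_on_vec_lambda)
    show "grad \<phi> x = 0" if "x \<notin> K" for x
    proof -
      have "((\<lambda>x. 0) has_derivative (\<lambda>v. 0)) (at x)"
        by simp
      then have "(\<phi> has_derivative (\<lambda>v. 0)) (at x)"
        by (rule has_derivative_transform_within_open[where s = "- K" and t = UNIV])
          (use K that in \<open>auto intro: compact_imp_closed\<close>)
      then show ?thesis
        by (simp add: grad_def vec_eq_iff frechet_derivative_at[symmetric])
    qed
  qed
qed

lemma weak_div_unique:
  assumes "bounded \<Omega>" "open \<Omega>" "d \<in> L2 \<Omega>" "d' \<in> L2 \<Omega>" "has_weak_div \<Omega> u d" "has_weak_div \<Omega> u d'"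
  shows "AE x in lebesgue_on \<Omega>. d x = d' x"
proof -
  have "AE x in lebesgue_on \<Omega>. d x + (- 1) *\<^sub>R d' x = 0"
  proof (rule orthogonal_to_test_functions_imp_AE_zero)
    show "integrable (lebesgue_on \<Omega>) (\<lambda>x. d x + (- 1) *\<^sub>R d' x)"
      using assms by (intro L2_integrable L2_add L2_scaleR)
    show "L2_inner \<Omega> (\<lambda>x. d x + (- 1) *\<^sub>R d' x) \<phi> = 0" if "\<phi> \<in> test_functions \<Omega>" for \<phi>
    proof -
      have "L2_inner \<Omega> (\<lambda>x. d x + (- 1) *\<^sub>R d' x) \<phi> = L2_inner \<Omega> d \<phi> + (- 1) * L2_inner \<Omega> d' \<phi>"
        using assms that L2_scaleR[OF assms(4), of "- 1"]
        by (simp only: L2_inner_add_left test_function_L2 L2_inner_scaleR_left)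
      then show ?thesis
        using assms that by (auto simp: has_weak_div_def)
    qed
  qed (use assms in auto)
  then show ?thesis
    by eventually_elim simp
qed

lemma Hdiv_L2: "u \<in> Hdiv \<Omega> \<Longrightarrow> u \<in> L2 \<Omega>"
  by (simp add: Hdiv_def)

lemma wdiv_props:
  assumes "u \<in> Hdiv \<Omega>"
  shows wdiv_L2: "wdiv \<Omega> u \<in> L2 \<Omega>" and wdiv_weak: "has_weak_div \<Omega> u (wdiv \<Omega> u)"
proof -
  have "\<exists>d. d \<in> L2 \<Omega> \<and> has_weak_div \<Omega> u d"
    using assms by (auto simp: Hdiv_def)
  from someI_ex[OF this] show "wdiv \<Omega> u \<in> L2 \<Omega>" "has_weak_div \<Omega> u (wdiv \<Omega> u)"
    by (auto simp: wdiv_def)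
qed

text \<open>A linear relation between weak divergences holds for each choice of representatives. Uniqueness
  then carries it over to the representative that \<open>wdiv\<close> selects, in \<open>wdiv_combination\<close>.\<close>

lemma has_weak_div_combination:
  assumes "bounded \<Omega>" "open \<Omega>" "u \<in> L2 \<Omega>" "v \<in> L2 \<Omega>" "d \<in> L2 \<Omega>" "e \<in> L2 \<Omega>"
    and "has_weak_div \<Omega> u d" "has_weak_div \<Omega> v e"
  shows "has_weak_div \<Omega> (\<lambda>x. a *\<^sub>R u x + b *\<^sub>R v x) (\<lambda>x. a *\<^sub>R d x + b *\<^sub>R e x)"
  unfolding has_weak_div_def
proof
  fix \<phi>
  assume \<phi>: "\<phi> \<in> test_functions \<Omega>"
  have "L2_inner \<Omega> (\<lambda>x. a *\<^sub>R u x + b *\<^sub>R v x) (grad \<phi>) = a * L2_inner \<Omega> u (grad \<phi>) + b * L2_inner \<Omega> v (grad \<phi>)"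
    using assms \<phi> by (simp add: L2_inner_add_left L2_scaleR grad_test_function_L2 L2_inner_scaleR_left)
  also have "\<dots> = - (a * L2_inner \<Omega> d \<phi> + b * L2_inner \<Omega> e \<phi>)"
    using assms \<phi> by (simp add: has_weak_div_def)
  also have "\<dots> = - L2_inner \<Omega> (\<lambda>x. a *\<^sub>R d x + b *\<^sub>R e x) \<phi>"
    using assms \<phi> L2_scaleR[OF assms(5), of a] L2_scaleR[OF assms(6), of b]
    by (simp only: L2_inner_add_left test_function_L2 L2_inner_scaleR_left)
  finally show "L2_inner \<Omega> (\<lambda>x. a *\<^sub>R u x + b *\<^sub>R v x) (grad \<phi>) = - L2_inner \<Omega> (\<lambda>x. a *\<^sub>R d x + b *\<^sub>R e x) \<phi>" .
qed

lemma Hdiv_combination: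
  assumes "bounded \<Omega>" "open \<Omega>" "u \<in> Hdiv \<Omega>" "v \<in> Hdiv \<Omega>"
  shows "(\<lambda>x. a *\<^sub>R u x + b *\<^sub>R v x) \<in> Hdiv \<Omega>"
proof -
  have "has_weak_div \<Omega> (\<lambda>x. a *\<^sub>R u x + b *\<^sub>R v x) (\<lambda>x. a *\<^sub>R wdiv \<Omega> u x + b *\<^sub>R wdiv \<Omega> v x)"
    by (intro has_weak_div_combination wdiv_weak wdiv_L2 Hdiv_L2 assms)
  moreover have "(\<lambda>x. a *\<^sub>R wdiv \<Omega> u x + b *\<^sub>R wdiv \<Omega> v x) \<in> L2 \<Omega>"
    by (intro L2_add L2_scaleR wdiv_L2 assms)
  moreover have "(\<lambda>x. a *\<^sub>R u x + b *\<^sub>R v x) \<in> L2 \<Omega>"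
    by (intro L2_add L2_scaleR Hdiv_L2 assms)
  ultimately show ?thesis
    unfolding Hdiv_def by blast
qed

lemma wdiv_combination:
  assumes "bounded \<Omega>" "open \<Omega>" "u \<in> Hdiv \<Omega>" "v \<in> Hdiv \<Omega>"
  shows "AE x in lebesgue_on \<Omega>. wdiv \<Omega> (\<lambda>x. a *\<^sub>R u x + b *\<^sub>R v x) x = a *\<^sub>R wdiv \<Omega> u x + b *\<^sub>R wdiv \<Omega> v x"
  by (rule weak_div_unique[OF assms(1,2) wdiv_L2 _ wdiv_weak])
    (intro has_weak_div_combination wdiv_weak wdiv_L2 Hdiv_combination L2_add L2_scaleR Hdiv_L2 assms)+

lemma wdiv_cong_AE:
  assumes "bounded \<Omega>" "open \<Omega>" "u \<in> Hdiv \<Omega>" "v \<in> Hdiv \<Omega>" "AE x in lebesgue_on \<Omega>. u x = v x"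
  shows "AE x in lebesgue_on \<Omega>. wdiv \<Omega> u x = wdiv \<Omega> v x"
proof (rule weak_div_unique[OF assms(1,2)])
  have "L2_inner \<Omega> u (grad \<phi>) = L2_inner \<Omega> v (grad \<phi>)" if "\<phi> \<in> test_functions \<Omega>" for \<phi>
    using assms that by (intro L2_inner_cong_AE) (auto intro: Hdiv_L2 grad_test_function_L2)
  then show "has_weak_div \<Omega> u (wdiv \<Omega> v)"
    using wdiv_weak[OF assms(4)] by (simp add: has_weak_div_def)
qed (use assms in \<open>auto intro: wdiv_L2 wdiv_weak\<close>)

text \<open>The trace functional refers to the chosen representative \<open>wdiv\<close>, so that its linearity in the
  field rests on the uniqueness of the weak divergence.\<close>

lemma Hdiv0_combination:
  assumes "bounded \<Omega>" "open \<Omega>" "u \<in> Hdiv0 \<Omega>" "v \<in> Hdiv0 \<Omega>"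
  shows "(\<lambda>x. a *\<^sub>R u x + b *\<^sub>R v x) \<in> Hdiv0 \<Omega>"
proof -
  have Hdiv: "u \<in> Hdiv \<Omega>" "v \<in> Hdiv \<Omega>" and tr: "zero_normal_trace \<Omega> u" "zero_normal_trace \<Omega> v"
    using assms by (auto simp: Hdiv0_def)
  have "L2_inner \<Omega> (\<lambda>x. a *\<^sub>R u x + b *\<^sub>R v x) g + L2_inner \<Omega> (wdiv \<Omega> (\<lambda>x. a *\<^sub>R u x + b *\<^sub>R v x)) w = 0"
    if "w \<in> L2 \<Omega>" "g \<in> L2 \<Omega>" "has_weak_grad \<Omega> w g" for w g
  proof -
    have "L2_inner \<Omega> (wdiv \<Omega> (\<lambda>x. a *\<^sub>R u x + b *\<^sub>R v x)) w
        = L2_inner \<Omega> (\<lambda>x. a *\<^sub>R wdiv \<Omega> u x + b *\<^sub>R wdiv \<Omega> v x) w"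
      using assms(1,2) Hdiv that
      by (intro L2_inner_cong_AE wdiv_combination wdiv_L2 Hdiv_combination L2_add L2_scaleR AE_I2 refl)
    also have "\<dots> = a * L2_inner \<Omega> (wdiv \<Omega> u) w + b * L2_inner \<Omega> (wdiv \<Omega> v) w"
      using L2_scaleR[OF wdiv_L2[OF Hdiv(1)], of a] L2_scaleR[OF wdiv_L2[OF Hdiv(2)], of b] that
      by (simp only: L2_inner_add_left L2_inner_scaleR_left)
    moreover have "L2_inner \<Omega> (\<lambda>x. a *\<^sub>R u x + b *\<^sub>R v x) g = a * L2_inner \<Omega> u g + b * L2_inner \<Omega> v g"
      using L2_scaleR[OF Hdiv_L2[OF Hdiv(1)], of a] L2_scaleR[OF Hdiv_L2[OF Hdiv(2)], of b] that
      by (simp only: L2_inner_add_left L2_inner_scaleR_left)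
    moreover have "a * L2_inner \<Omega> u g + b * L2_inner \<Omega> v g
        + (a * L2_inner \<Omega> (wdiv \<Omega> u) w + b * L2_inner \<Omega> (wdiv \<Omega> v) w)
        = a * (L2_inner \<Omega> u g + L2_inner \<Omega> (wdiv \<Omega> u) w) + b * (L2_inner \<Omega> v g + L2_inner \<Omega> (wdiv \<Omega> v) w)"
      by (simp add: algebra_simps)
    ultimately show ?thesis
      using tr that by (simp add: zero_normal_trace_def)
  qed
  with Hdiv assms(1,2) show ?thesis
    by (simp add: Hdiv0_def zero_normal_trace_def Hdiv_combination)
qed

lemma Hdiv0_zero: "bounded \<Omega> \<Longrightarrow> open \<Omega> \<Longrightarrow> (\<lambda>x. 0) \<in> Hdiv0 \<Omega>"
proof -
  assume \<Omega>: "bounded \<Omega>" "open \<Omega>"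
  have weak: "has_weak_div \<Omega> (\<lambda>x. 0) (\<lambda>x. 0)"
    by (simp add: has_weak_div_def L2_inner_def)
  then have Hdiv: "(\<lambda>x. 0) \<in> Hdiv \<Omega>"
    unfolding Hdiv_def by (intro CollectI conjI bexI[OF _ L2_zero] L2_zero)
  have "AE x in lebesgue_on \<Omega>. wdiv \<Omega> (\<lambda>x. 0) x = 0"
    by (rule weak_div_unique[OF \<Omega> wdiv_L2[OF Hdiv] L2_zero wdiv_weak[OF Hdiv] weak])
  then have "L2_inner \<Omega> (wdiv \<Omega> (\<lambda>x. 0)) w = L2_inner \<Omega> (\<lambda>x. 0) w" if "w \<in> L2 \<Omega>" for w
    by (intro L2_inner_cong_AE) (auto simp: that intro: wdiv_L2 Hdiv L2_zero)
  with Hdiv show ?thesis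
    by (simp add: Hdiv0_def zero_normal_trace_def) (simp add: L2_inner_def)
qed

section \<open>The mixed finite element spaces\<close>

definition closed_under_combinations :: "('a \<Rightarrow> 'b::real_vector) set \<Rightarrow> bool" where
  "closed_under_combinations W \<longleftrightarrow> (\<lambda>x. 0) \<in> W \<and> (\<forall>u\<in>W. \<forall>v\<in>W. \<forall>a b. (\<lambda>x. a *\<^sub>R u x + b *\<^sub>R v x) \<in> W)"

lemma closed_under_combinationsD:
  assumes "closed_under_combinations S" "u \<in> S" "v \<in> S"
  shows "(\<lambda>x. a *\<^sub>R u x + b *\<^sub>R v x) \<in> S"
  using assms unfolding closed_under_combinations_def by simp

lemma poly_fun_combination:
  assumes "p \<in> poly_fun k" "q \<in> poly_fun k"
  shows "(\<lambda>x. a * p x + b * q x) \<in> poly_fun k"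
proof -
  obtain c d where "\<And>x. p x = (\<Sum>i\<le>k. \<Sum>j\<le>k - i. c i j * (x $ 1) ^ i * (x $ 2) ^ j)"
    "\<And>x. q x = (\<Sum>i\<le>k. \<Sum>j\<le>k - i. d i j * (x $ 1) ^ i * (x $ 2) ^ j)"
    using assms by (auto simp: poly_fun_def)
  then have "a * p x + b * q x = (\<Sum>i\<le>k. \<Sum>j\<le>k - i. (a * c i j + b * d i j) * (x $ 1) ^ i * (x $ 2) ^ j)" for x
    by (simp add: sum_distrib_left sum.distrib algebra_simps)
  then show ?thesis
    unfolding poly_fun_def by (intro CollectI exI[of _ "\<lambda>i j. a * c i j + b * d i j"]) blast
qed

lemma poly_fun_zero: "(\<lambda>x. 0) \<in> poly_fun k"
  unfolding poly_fun_def by (intro CollectI exI[of _ "\<lambda>i j. 0"]) auto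

lemma poly_field_combination:
  "p \<in> poly_field k \<Longrightarrow> q \<in> poly_field k \<Longrightarrow> (\<lambda>x. a *\<^sub>R p x + b *\<^sub>R q x) \<in> poly_field k"
  by (auto simp: poly_field_def intro: poly_fun_combination)

lemma poly_field_zero: "(\<lambda>x. 0) \<in> poly_field k"
  by (auto simp: poly_field_def intro: poly_fun_zero)

lemma closed_RT: "closed_under_combinations (RT k T)"
  unfolding closed_under_combinations_def
proof safe
  show "(\<lambda>x. 0) \<in> RT k T"
    unfolding RT_def
    by (rule CollectI, rule exI[of _ "\<lambda>x. 0"], rule exI[of _ "\<lambda>x. 0"]) (auto intro: poly_field_zero poly_fun_zero)
  fix u v a b
  assume "u \<in> RT k T" "v \<in> RT k T"
  then obtain p q p' q' where
    "u = (\<lambda>x. p x + q x *\<^sub>R x)" "p \<in> poly_field k" "q \<in> poly_fun k"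
    "v = (\<lambda>x. p' x + q' x *\<^sub>R x)" "p' \<in> poly_field k" "q' \<in> poly_fun k"
    by (auto simp: RT_def)
  then show "(\<lambda>x. a *\<^sub>R u x + b *\<^sub>R v x) \<in> RT k T"
    unfolding RT_def
    by (intro CollectI exI[of _ "\<lambda>x. a *\<^sub>R p x + b *\<^sub>R p' x"] exI[of _ "\<lambda>x. a * q x + b * q' x"])
      (auto intro: poly_field_combination poly_fun_combination simp: algebra_simps)
qed

lemma closed_BDM: "closed_under_combinations (BDM k T)"
  by (auto simp: closed_under_combinations_def BDM_def intro: poly_field_combination poly_field_zero)

lemma closed_BDFM: "closed_under_combinations (BDFM k T)"
  unfolding closed_under_combinations_def
proof safe
  show "(\<lambda>x. 0) \<in> BDFM k T"
    unfolding BDFM_def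
    by (intro CollectI conjI poly_field_zero allI impI bexI[OF _ poly_fun_zero]) simp
  fix u v a b
  assume uv: "u \<in> BDFM k T" "v \<in> BDFM k T"
  have "\<exists>q\<in>poly_fun (k - 1). \<forall>x\<in>e. (a *\<^sub>R u x + b *\<^sub>R v x) \<bullet> n = q x"
    if en: "e edge_of T" "\<forall>x\<in>e. \<forall>y\<in>e. n \<bullet> (x - y) = 0" for e n
  proof -
    have trace: "\<exists>q\<in>poly_fun (k - 1). \<forall>x\<in>e. w x \<bullet> n = q x" if "w \<in> BDFM k T" for w
      using that en by (simp add: BDFM_def)
    obtain p q where "p \<in> poly_fun (k - 1)" "\<forall>x\<in>e. u x \<bullet> n = p x"
      and "q \<in> poly_fun (k - 1)" "\<forall>x\<in>e. v x \<bullet> n = q x"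
      using trace[OF uv(1)] trace[OF uv(2)] by (elim bexE)
    then show ?thesis
      by (intro bexI[OF _ poly_fun_combination[of p _ q a b]]) (auto simp: inner_add_left)
  qed
  then show "(\<lambda>x. a *\<^sub>R u x + b *\<^sub>R v x) \<in> BDFM k T"
    using uv by (simp add: BDFM_def poly_field_combination)
qed

lemma closed_piecewise_space:
  assumes "bounded \<Omega>" "open \<Omega>" and P: "\<And>T. closed_under_combinations (P T)"
  shows "closed_under_combinations (piecewise_space \<Omega> \<T> P)"
  unfolding closed_under_combinations_def
proof safe
  show "(\<lambda>x. 0) \<in> piecewise_space \<Omega> \<T> P"
  proof -
    have "(\<lambda>x. 0) \<in> P T" for T
      using P by (simp add: closed_under_combinations_def)
    then show ?thesis
      using Hdiv0_zero[OF assms(1,2)] unfolding piecewise_space_def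
      by (intro CollectI conjI ballI) (assumption, rule bexI, rule AE_I2, rule refl, assumption)
  qed
  fix u v a b
  assume uv: "u \<in> piecewise_space \<Omega> \<T> P" "v \<in> piecewise_space \<Omega> \<T> P"
  have "\<exists>r\<in>P T. AE x in lebesgue_on T. a *\<^sub>R u x + b *\<^sub>R v x = r x" if "T \<in> \<T>" for T
  proof -
    have rep: "\<exists>p\<in>P T. AE x in lebesgue_on T. w x = p x" if "w \<in> piecewise_space \<Omega> \<T> P" for w
      using that \<open>T \<in> \<T>\<close> by (simp add: piecewise_space_def)
    obtain p q where pq: "p \<in> P T" "AE x in lebesgue_on T. u x = p x" "q \<in> P T" "AE x in lebesgue_on T. v x = q x"
      using rep[OF uv(1)] rep[OF uv(2)] by (elim bexE)
    have "AE x in lebesgue_on T. a *\<^sub>R u x + b *\<^sub>R v x = a *\<^sub>R p x + b *\<^sub>R q x"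
      using pq(2,4) by eventually_elim simp
    moreover have "(\<lambda>x. a *\<^sub>R p x + b *\<^sub>R q x) \<in> P T"
      using P[of T] pq by (simp add: closed_under_combinations_def)
    ultimately show ?thesis
      by (intro bexI)
  qed
  moreover have "(\<lambda>x. a *\<^sub>R u x + b *\<^sub>R v x) \<in> Hdiv0 \<Omega>"
    using uv by (intro Hdiv0_combination[OF assms(1,2)]) (simp_all add: piecewise_space_def)
  ultimately show "(\<lambda>x. a *\<^sub>R u x + b *\<^sub>R v x) \<in> piecewise_space \<Omega> \<T> P"
    unfolding piecewise_space_def by (intro CollectI conjI ballI)
qed

text \<open>The index \<open>None\<close> stands for a monomial times the position vector, which is what Raviart-Thomas
  fields have in addition to polynomial fields; \<open>Some l\<close> stands for a monomial times the \<open>l\<close>-th unit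
  vector.\<close>

definition field_generator :: "2 option \<times> nat \<times> nat \<Rightarrow> real ^ 2 \<Rightarrow> real ^ 2" where
  "field_generator = (\<lambda>(d, i, j) x. (x $ 1 ^ i * x $ 2 ^ j) *\<^sub>R (case d of None \<Rightarrow> x | Some l \<Rightarrow> axis l 1))"

text \<open>The triangle \<open>i + j \<le> k\<close> of exponents is filled up to a square, so that one index set serves all
  components.\<close>

lemma poly_fun_monomials:
  assumes "p \<in> poly_fun k"
  shows "\<exists>c. \<forall>x. p x = (\<Sum>(i, j)\<in>{..k} \<times> {..k}. c (i, j) * (x $ 1 ^ i * x $ 2 ^ j))"
proof -
  obtain c where c: "\<And>x. p x = (\<Sum>i\<le>k. \<Sum>j\<le>k - i. c i j * (x $ 1) ^ i * (x $ 2) ^ j)"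
    using assms by (auto simp: poly_fun_def)
  let ?c = "\<lambda>(i, j). if j \<le> k - i then c i j else 0"
  have "p x = (\<Sum>(i, j)\<in>{..k} \<times> {..k}. ?c (i, j) * (x $ 1 ^ i * x $ 2 ^ j))" for x
  proof -
    have "(\<Sum>j\<le>k - i. c i j * (x $ 1) ^ i * (x $ 2) ^ j) = (\<Sum>j\<le>k. ?c (i, j) * (x $ 1 ^ i * x $ 2 ^ j))" for i
      by (intro sum.mono_neutral_cong_left) auto
    then show ?thesis
      by (simp add: c sum.cartesian_product)
  qed
  then show ?thesis
    by (intro exI[of _ ?c]) blast
qed

lemma RT_generators:
  assumes "v \<in> RT k T"
  shows "\<exists>c. \<forall>x. v x = (\<Sum>g\<in>UNIV \<times> {..k} \<times> {..k}. c g *\<^sub>R field_generator g x)"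
proof -
  obtain p q where v: "v = (\<lambda>x. p x + q x *\<^sub>R x)" and p: "\<And>l. (\<lambda>x. p x $ l) \<in> poly_fun k" and q: "q \<in> poly_fun k"
    using assms by (auto simp: RT_def poly_field_def)
  obtain cq where cq: "\<And>x. q x = (\<Sum>(i, j)\<in>{..k} \<times> {..k}. cq (i, j) * (x $ 1 ^ i * x $ 2 ^ j))"
    using poly_fun_monomials[OF q] by blast
  have "\<forall>l. \<exists>c. \<forall>x. p x $ l = (\<Sum>(i, j)\<in>{..k} \<times> {..k}. c (i, j) * (x $ 1 ^ i * x $ 2 ^ j))"
    by (intro allI poly_fun_monomials p)
  from choice[OF this] obtain cp where cp: "\<And>l x. p x $ l = (\<Sum>(i, j)\<in>{..k} \<times> {..k}. cp l (i, j) * (x $ 1 ^ i * x $ 2 ^ j))"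
    by (elim exE) simp
  let ?c = "\<lambda>(d, ij). case d of None \<Rightarrow> cq ij | Some l \<Rightarrow> cp l ij"
  have "v x = (\<Sum>g\<in>UNIV \<times> {..k} \<times> {..k}. ?c g *\<^sub>R field_generator g x)" for x
  proof -
    have "(\<Sum>g\<in>UNIV \<times> {..k} \<times> {..k}. ?c g *\<^sub>R field_generator g x)
        = (\<Sum>d\<in>UNIV. \<Sum>ij\<in>{..k} \<times> {..k}. ?c (d, ij) *\<^sub>R field_generator (d, ij) x)"
      by (simp add: sum.cartesian_product split_beta)
    also have "\<dots> = (\<Sum>ij\<in>{..k} \<times> {..k}. ?c (None, ij) *\<^sub>R field_generator (None, ij) x)
        + (\<Sum>l\<in>UNIV. \<Sum>ij\<in>{..k} \<times> {..k}. ?c (Some l, ij) *\<^sub>R field_generator (Some l, ij) x)"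
      by (simp add: UNIV_option_conv sum.reindex)
    also have "(\<Sum>ij\<in>{..k} \<times> {..k}. ?c (None, ij) *\<^sub>R field_generator (None, ij) x) = q x *\<^sub>R x"
      by (simp add: cq field_generator_def scaleR_sum_left split_beta)
    also have "(\<Sum>l\<in>UNIV. \<Sum>ij\<in>{..k} \<times> {..k}. ?c (Some l, ij) *\<^sub>R field_generator (Some l, ij) x)
        = (\<Sum>l\<in>UNIV. (p x $ l) *\<^sub>R axis l 1)"
      by (simp add: cp field_generator_def scaleR_sum_left split_beta)
    also have "\<dots> = p x"
      by (simp add: vec_eq_iff axis_def if_distrib cong: if_cong)
    finally show ?thesis
      by (simp add: v)
  qed
  then show ?thesis
    by (intro exI[of _ ?c]) blast
qed

text \<open>Each point of \<open>\<Omega>\<close> is assigned to a single triangle containing it. Any choice on shared edges will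
  do, because outside a null set every triangle through a point gives the value of \<open>v\<close> there.\<close>

lemma piecewise_generators:
  assumes \<Omega>: "open \<Omega>" and mesh: "triangle_mesh \<Omega> \<T>"
    and P: "\<And>T p. T \<in> \<T> \<Longrightarrow> p \<in> P T \<Longrightarrow> \<exists>c. \<forall>x. p x = (\<Sum>g\<in>J. c g *\<^sub>R b g x)"
    and v: "v \<in> piecewise_space \<Omega> \<T> P"
  shows "\<exists>c. AE x in lebesgue_on \<Omega>.
    v x = (\<Sum>(T, g)\<in>\<T> \<times> J. c (T, g) *\<^sub>R (if (SOME T. T \<in> \<T> \<and> x \<in> T) = T then b g x else 0))"
proof -
  let ?sel = "\<lambda>x. SOME T. T \<in> \<T> \<and> x \<in> T"
  have fin: "finite \<T>" and cover: "\<Union>\<T> = closure \<Omega>"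
    and simplices: "\<And>T. T \<in> \<T> \<Longrightarrow> 2 simplex T"
    using mesh by (auto simp: triangle_mesh_def triangulation_def)
  have meas: "T \<in> sets lebesgue" if "T \<in> \<T>" for T
    using fmeasurableD[OF lmeasurable_compact[OF compact_simplex[OF simplices[OF that]]]] .
  have "\<exists>c. AE x in lebesgue. x \<in> T \<longrightarrow> v x = (\<Sum>g\<in>J. c g *\<^sub>R b g x)" if T: "T \<in> \<T>" for T
  proof -
    have "\<exists>p\<in>P T. AE x in lebesgue_on T. v x = p x"
      using v T by (simp add: piecewise_space_def)
    then obtain p where p: "p \<in> P T" "AE x in lebesgue_on T. v x = p x"
      by (elim bexE)
    obtain c where "\<And>x. p x = (\<Sum>g\<in>J. c g *\<^sub>R b g x)"
      using P[OF T p(1)] by (elim exE) simp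
    with p(2) have "AE x in lebesgue_on T. v x = (\<Sum>g\<in>J. c g *\<^sub>R b g x)"
      by simp
    then show ?thesis
      using meas[OF T] by (intro exI[of _ c]) (simp add: AE_restrict_space_iff)
  qed
  then have "\<forall>T\<in>\<T>. \<exists>c. AE x in lebesgue. x \<in> T \<longrightarrow> v x = (\<Sum>g\<in>J. c g *\<^sub>R b g x)"
    by (rule ballI)
  from bchoice[OF this] obtain c where
    c: "\<forall>T\<in>\<T>. AE x in lebesgue. x \<in> T \<longrightarrow> v x = (\<Sum>g\<in>J. c T g *\<^sub>R b g x)"
    ..
  then have "AE x in lebesgue. \<forall>T\<in>\<T>. x \<in> T \<longrightarrow> v x = (\<Sum>g\<in>J. c T g *\<^sub>R b g x)"
    using fin by (simp add: AE_ball_countable countable_finite)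
  then have "AE x in lebesgue. x \<in> \<Omega> \<longrightarrow>
    v x = (\<Sum>(T, g)\<in>\<T> \<times> J. c T g *\<^sub>R (if ?sel x = T then b g x else 0))"
  proof eventually_elim
    case (elim x)
    show ?case
    proof
      assume "x \<in> \<Omega>"
      then have "x \<in> \<Union>\<T>"
        using cover closure_subset by blast
      then have sel: "?sel x \<in> \<T>" "x \<in> ?sel x"
        using someI_ex[of "\<lambda>T. T \<in> \<T> \<and> x \<in> T"] by auto
      have "(\<Sum>(T, g)\<in>\<T> \<times> J. c T g *\<^sub>R (if ?sel x = T then b g x else 0))
          = (\<Sum>T\<in>\<T>. \<Sum>g\<in>J. c T g *\<^sub>R (if ?sel x = T then b g x else 0))"
        by (simp add: sum.cartesian_product)
      also have "\<dots> = (\<Sum>T\<in>\<T>. if ?sel x = T then (\<Sum>g\<in>J. c T g *\<^sub>R b g x) else 0)"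
        by (intro sum.cong) auto
      also have "\<dots> = (\<Sum>g\<in>J. c (?sel x) g *\<^sub>R b g x)"
        using sel fin by simp
      also have "\<dots> = v x"
        using elim sel by simp
      finally show "v x = (\<Sum>(T, g)\<in>\<T> \<times> J. c T g *\<^sub>R (if ?sel x = T then b g x else 0))" ..
    qed
  qed
  then have "AE x in lebesgue_on \<Omega>.
    v x = (\<Sum>(T, g)\<in>\<T> \<times> J. c T g *\<^sub>R (if ?sel x = T then b g x else 0))"
    using \<Omega> by (subst AE_restrict_space_iff) simp_all
  then show ?thesis
    by (intro exI[of _ "\<lambda>(T, g). c T g"]) simp
qed

lemma mixed_fe_space_closed:
  assumes "bounded \<Omega>" "open \<Omega>" "mixed_fe_space \<Omega> W"
  shows "closed_under_combinations W"
  using assms(3) closed_piecewise_space[OF assms(1,2) closed_RT] closed_piecewise_space[OF assms(1,2) closed_BDM]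
    closed_piecewise_space[OF assms(1,2) closed_BDFM]
  unfolding mixed_fe_space_def by (elim exE conjE disjE) simp_all

lemma mixed_fe_space_Hdiv0: "mixed_fe_space \<Omega> W \<Longrightarrow> W \<subseteq> Hdiv0 \<Omega>"
  unfolding mixed_fe_space_def by (elim exE conjE disjE) (simp_all add: piecewise_space_def subset_iff)

text \<open>The local spaces of all three families lie in a Raviart-Thomas space, so its generators suffice.
  Only equality almost everywhere can be asked for: the space contains every representative of
  its elements.\<close>

lemma mixed_fe_space_finite_dim:
  assumes "open \<Omega>" "mixed_fe_space \<Omega> W"
  shows "\<exists>(I :: ((real ^ 2) set \<times> 2 option \<times> nat \<times> nat) set) b.
    finite I \<and> (\<forall>v\<in>W. \<exists>c. AE x in lebesgue_on \<Omega>. v x = (\<Sum>i\<in>I. c i *\<^sub>R b i x))"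
proof -
  have RT_0: "v \<in> RT k T" if "v \<in> poly_field k" for v k T
  proof -
    have "v x = v x + 0 *\<^sub>R x" for x
      by simp
    then show ?thesis
      unfolding RT_def using that poly_fun_zero[of k] by (intro CollectI exI[of _ v] exI[of _ "\<lambda>x. 0"] conjI) auto
  qed
  obtain \<T> P k where mesh: "triangle_mesh \<Omega> \<T>" and W: "W = piecewise_space \<Omega> \<T> P" and P: "\<And>T. P T \<subseteq> RT k T"
  proof -
    obtain \<T> where mesh: "triangle_mesh \<Omega> \<T>"
      and cases: "(\<exists>k. W = piecewise_space \<Omega> \<T> (RT k)) \<or> (\<exists>k\<ge>1. W = piecewise_space \<Omega> \<T> (BDM k)) \<or>
      (\<exists>k\<ge>1. W = piecewise_space \<Omega> \<T> (BDFM k))"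
      using assms(2) unfolding mixed_fe_space_def by (elim exE conjE)
    from cases show thesis
    proof (elim disjE exE conjE)
      fix k
      assume "W = piecewise_space \<Omega> \<T> (RT k)"
      then show thesis by (rule that[where k = k, OF mesh]) simp
    next
      fix k
      assume "W = piecewise_space \<Omega> \<T> (BDM k)"
      then show thesis by (rule that[where k = k, OF mesh]) (auto simp: BDM_def intro: RT_0)
    next
      fix k
      assume "W = piecewise_space \<Omega> \<T> (BDFM k)"
      then show thesis by (rule that[where k = k, OF mesh]) (auto simp: BDFM_def intro: RT_0)
    qed
  qed
  let ?J = "UNIV \<times> {..k} \<times> {..k} :: (2 option \<times> nat \<times> nat) set"
  let ?b = "\<lambda>(T, g) x. if (SOME T. T \<in> \<T> \<and> x \<in> T) = T then field_generator g x else 0"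
  have "\<exists>c. AE x in lebesgue_on \<Omega>. v x = (\<Sum>i\<in>\<T> \<times> ?J. c i *\<^sub>R ?b i x)" if "v \<in> W" for v
  proof -
    have "\<exists>c. AE x in lebesgue_on \<Omega>. v x = (\<Sum>(T, g)\<in>\<T> \<times> ?J. c (T, g) *\<^sub>R
        (if (SOME T. T \<in> \<T> \<and> x \<in> T) = T then field_generator g x else 0))"
      using that P by (intro piecewise_generators[OF assms(1) mesh _ that[unfolded W]] RT_generators) auto
    then show ?thesis
      by (simp add: split_beta)
  qed
  moreover have "finite (\<T> \<times> ?J)"
    using mesh by (auto simp: triangle_mesh_def triangulation_def)
  ultimately show ?thesis
    by (intro exI[of _ "\<T> \<times> ?J"] exI[of _ ?b] conjI ballI)
qed

section \<open>Semi-inner products on function spaces\<close>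

text \<open>Fields are functions and not classes of functions, so the forms below are only semidefinite, and
  vectors are equal only up to the null space of the form. The locale collects what remains true
  in this situation.\<close>

locale semi_inner_space =
  fixes W :: "('a \<Rightarrow> 'b::real_vector) set" and B :: "('a \<Rightarrow> 'b) \<Rightarrow> ('a \<Rightarrow> 'b) \<Rightarrow> real"
  assumes closed: "closed_under_combinations W"
    and combination_left: "\<And>u v w a b. u \<in> W \<Longrightarrow> v \<in> W \<Longrightarrow> w \<in> W \<Longrightarrow>
      B (\<lambda>x. a *\<^sub>R u x + b *\<^sub>R v x) w = a * B u w + b * B v w"
    and sym: "\<And>u v. u \<in> W \<Longrightarrow> v \<in> W \<Longrightarrow> B u v = B v u"
    and nonneg: "\<And>u. u \<in> W \<Longrightarrow> 0 \<le> B u u"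
begin

lemma combination_mem: "u \<in> W \<Longrightarrow> v \<in> W \<Longrightarrow> (\<lambda>x. a *\<^sub>R u x + b *\<^sub>R v x) \<in> W"
  using closed by (simp add: closed_under_combinations_def)

lemma combination_right:
  "u \<in> W \<Longrightarrow> v \<in> W \<Longrightarrow> w \<in> W \<Longrightarrow> B w (\<lambda>x. a *\<^sub>R u x + b *\<^sub>R v x) = a * B w u + b * B w v"
  by (simp add: sym[of w] combination_mem combination_left)

lemma Cauchy_Schwarz:
  assumes "u \<in> W" "v \<in> W"
  shows "\<bar>B u v\<bar> \<le> sqrt (B u u) * sqrt (B v v)"
proof -
  have quad: "0 \<le> B u u + 2 * r * B u v + r\<^sup>2 * B v v" for r
  proof -
    have "0 \<le> B (\<lambda>x. 1 *\<^sub>R u x + r *\<^sub>R v x) (\<lambda>x. 1 *\<^sub>R u x + r *\<^sub>R v x)"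
      using assms by (intro nonneg combination_mem)
    also have "\<dots> = B u u + 2 * r * B u v + r\<^sup>2 * B v v"
      using assms by (simp only: combination_left combination_right combination_mem sym[of v u])
        (simp add: algebra_simps power2_eq_square)
    finally show ?thesis .
  qed
  have "(B u v)\<^sup>2 \<le> B u u * B v v"
  proof (cases "B v v = 0")
    case True
    have "B u v = 0"
    proof (rule ccontr)
      assume "B u v \<noteq> 0"
      then show False
        using quad[of "- (B u u + 1) / (2 * B u v)"] True by (simp add: field_simps)
    qed
    with True show ?thesis
      by simp
  next
    case False
    then have "B v v > 0"
      using nonneg[OF assms(2)] by simp
    then show ?thesis
      using quad[of "- B u v / B v v"] by (simp add: field_simps power2_eq_square)
  qed
  then have "sqrt ((B u v)\<^sup>2) \<le> sqrt (B u u * B v v)"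
    by (rule real_sqrt_le_mono)
  then show ?thesis
    by (simp add: real_sqrt_mult)
qed

lemma null_orthogonal:
  assumes "u \<in> W" "v \<in> W" "B v v = 0"
  shows "B u v = 0"
  using Cauchy_Schwarz[OF assms(1,2)] assms(3) by simp

lemma sum_list_mem:
  assumes "closed_under_combinations S" "set es \<subseteq> S"
  shows "(\<lambda>x. \<Sum>e\<leftarrow>es. k e *\<^sub>R e x) \<in> S"
  using assms(2)
proof (induction es)
  case Nil
  show ?case
    using assms(1) by (simp add: closed_under_combinations_def)
next
  case (Cons e es)
  then have "(\<lambda>x. k e *\<^sub>R e x + 1 *\<^sub>R (\<Sum>e\<leftarrow>es. k e *\<^sub>R e x)) \<in> S"
    by (intro closed_under_combinationsD[OF assms(1)]) auto
  then show ?case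
    by simp
qed

lemma zero_left: "w \<in> W \<Longrightarrow> B (\<lambda>x. 0) w = 0"
  using combination_left[of w w w 0 0] by simp

lemma sum_list_left:
  assumes "set es \<subseteq> W" "w \<in> W"
  shows "B (\<lambda>x. \<Sum>e\<leftarrow>es. k e *\<^sub>R e x) w = (\<Sum>e\<leftarrow>es. k e * B e w)"
  using assms(1)
proof (induction es)
  case Nil
  then show ?case
    using zero_left[OF assms(2)] by simp
next
  case (Cons e es)
  then have "B (\<lambda>x. k e *\<^sub>R e x + 1 *\<^sub>R (\<Sum>e\<leftarrow>es. k e *\<^sub>R e x)) w
      = k e * B e w + 1 * B (\<lambda>x. \<Sum>e\<leftarrow>es. k e *\<^sub>R e x) w"
    using sum_list_mem[OF closed, of es k] assms(2) by (intro combination_left) auto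
  then show ?case
    using Cons by simp
qed

text \<open>The component of \<open>u\<close> orthogonal to the fields in \<open>es\<close>, when these are pairwise orthogonal. Members of
  length zero contribute nothing, by the convention for division by zero.\<close>

definition residual :: "('a \<Rightarrow> 'b) list \<Rightarrow> ('a \<Rightarrow> 'b) \<Rightarrow> 'a \<Rightarrow> 'b" where
  "residual es u x = u x - (\<Sum>e\<leftarrow>es. (B u e / B e e) *\<^sub>R e x)"

lemma residual_eq:
  "residual es u = (\<lambda>x. 1 *\<^sub>R u x + (- 1) *\<^sub>R (\<Sum>e\<leftarrow>es. (B u e / B e e) *\<^sub>R e x))"
  by (simp add: residual_def fun_eq_iff)

lemma residual_mem:
  assumes "closed_under_combinations S" "set es \<subseteq> S" "u \<in> S"
  shows "residual es u \<in> S"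
  unfolding residual_eq
  by (rule closed_under_combinationsD[OF assms(1,3) sum_list_mem[OF assms(1,2)]])

lemma residual_left:
  assumes "set es \<subseteq> W" "u \<in> W" "w \<in> W"
  shows "B (residual es u) w = B u w - (\<Sum>e\<leftarrow>es. B u e * B e w / B e e)"
  using combination_left[OF assms(2) sum_list_mem[OF closed assms(1)] assms(3), of 1 "- 1"]
    sum_list_left[OF assms(1,3)]
  by (simp add: residual_eq)

text \<open>Parseval's identity against members of \<open>S\<close>. It implies that \<open>residual es u\<close> is orthogonal to \<open>S\<close>, and it
  is this scalar form of the projection, linear in \<open>u\<close> on the nose, that can be differentiated in
  time.\<close>

definition orthogonal_expansion :: "('a \<Rightarrow> 'b) set \<Rightarrow> ('a \<Rightarrow> 'b) list \<Rightarrow> bool" where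
  "orthogonal_expansion S es \<longleftrightarrow> set es \<subseteq> S \<and>
     (\<forall>u\<in>W. \<forall>w\<in>S. B u w = (\<Sum>e\<leftarrow>es. B u e * B e w / B e e))"

lemma residual_orthogonal:
  assumes "orthogonal_expansion S es" "S \<subseteq> W" "u \<in> W" "w \<in> S"
  shows "B (residual es u) w = 0"
  using assms residual_left[of es u w] by (auto simp: orthogonal_expansion_def)

text \<open>Gram-Schmidt, by induction on the set of coordinates. Coordinates enter as a relation, because
  generators that are linearly dependent up to null sets leave them undetermined. If the
  subspace \<open>S'\<close> of vectors with a vanishing new coordinate is not all of \<open>S\<close>, it has codimension one
  in \<open>S\<close>, and the list for \<open>S'\<close> is extended by one vector of \<open>S\<close> made orthogonal to \<open>S'\<close>.\<close>

lemma finite_dim_orthogonal_expansion: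
  fixes I :: "'i set" and coords :: "('a \<Rightarrow> 'b) \<Rightarrow> ('i \<Rightarrow> real) \<Rightarrow> bool"
  assumes "finite I" "S \<subseteq> W" "closed_under_combinations S"
    and "\<And>u. u \<in> S \<Longrightarrow> \<exists>c. coords u c"
    and "\<And>u v c d a b. u \<in> S \<Longrightarrow> v \<in> S \<Longrightarrow> coords u c \<Longrightarrow> coords v d \<Longrightarrow>
      coords (\<lambda>x. a *\<^sub>R u x + b *\<^sub>R v x) (\<lambda>i. a * c i + b * d i)"
    and "\<And>u c. u \<in> S \<Longrightarrow> coords u c \<Longrightarrow> \<forall>i\<in>I. c i = 0 \<Longrightarrow> B u u = 0"
  shows "\<exists>es. orthogonal_expansion S es"
  using assms
proof (induction I arbitrary: S coords rule: finite_induct)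
  case empty
  have "B u w = 0" if uw: "u \<in> W" "w \<in> S" for u w
  proof (rule null_orthogonal[OF uw(1)])
    show "w \<in> W"
      using empty(1) uw by blast
    obtain c where "coords w c"
      using empty(3)[OF uw(2)] by (elim exE)
    then show "B w w = 0"
      by (rule empty(5)[OF uw(2)]) simp
  qed
  then have "orthogonal_expansion S []"
    by (auto simp: orthogonal_expansion_def)
  then show ?case ..
next
  case (insert n I)
  define S' where "S' = {u \<in> S. \<exists>c. coords u c \<and> c n = 0}"
  have comb: "(\<lambda>x. a *\<^sub>R u x + b *\<^sub>R v x) \<in> S" if "u \<in> S" "v \<in> S" for u v a b
    using insert.prems(2) that by (simp add: closed_under_combinations_def)
  have comb': "(\<lambda>x. a *\<^sub>R u x + b *\<^sub>R v x) \<in> S'"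
    if uv: "u \<in> S'" "v \<in> S'" for u v a b
  proof -
    obtain c d where "coords u c" "c n = 0" "coords v d" "d n = 0"
      using uv by (auto simp: S'_def)
    then have "coords (\<lambda>x. a *\<^sub>R u x + b *\<^sub>R v x) (\<lambda>i. a * c i + b * d i)" "a * c n + b * d n = 0"
      using insert.prems(4)[of u v c d] uv by (auto simp: S'_def)
    moreover have "(\<lambda>x. a *\<^sub>R u x + b *\<^sub>R v x) \<in> S"
      using uv by (intro comb) (simp_all add: S'_def)
    ultimately show ?thesis
      unfolding S'_def by (intro CollectI conjI exI)
  qed
  have "(\<lambda>x. 0) \<in> S'"
  proof -
    have "(\<lambda>x. 0) \<in> S"
      using insert.prems(2) by (simp add: closed_under_combinations_def)
    moreover obtain c where "coords (\<lambda>x. 0) c"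
      using insert.prems(3)[OF calculation] by (elim exE)
    ultimately have "coords (\<lambda>x. 0) (\<lambda>i. 0)"
      using insert.prems(4)[of "\<lambda>x. 0" "\<lambda>x. 0" c c 0 0] by simp
    with \<open>(\<lambda>x. 0) \<in> S\<close> show ?thesis
      unfolding S'_def by (intro CollectI conjI exI[of _ "\<lambda>i. 0"]) simp_all
  qed
  with comb' have S'_closed: "closed_under_combinations S'"
    by (simp add: closed_under_combinations_def)
  have "\<exists>es. orthogonal_expansion S' es"
  proof (rule insert.IH[of S' "\<lambda>u c. coords u c \<and> c n = 0"])
    show "B u u = 0" if "u \<in> S'" "coords u c \<and> c n = 0" "\<forall>i\<in>I. c i = 0" for u c
      using insert.prems(5)[of u c] that by (auto simp: S'_def)
    show "coords (\<lambda>x. a *\<^sub>R u x + b *\<^sub>R v x) (\<lambda>i. a * c i + b * d i) \<and> a * c n + b * d n = 0"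
      if "u \<in> S'" "v \<in> S'" "coords u c \<and> c n = 0" "coords v d \<and> d n = 0" for u v c d a b
      using insert.prems(4)[of u v c d a b] that by (simp add: S'_def)
    show "\<exists>c. coords u c \<and> c n = 0" if "u \<in> S'" for u
      using that by (simp add: S'_def)
    show "S' \<subseteq> W"
      using insert.prems(1) by (auto simp: S'_def)
  qed (rule S'_closed)
  then obtain es where es: "orthogonal_expansion S' es"
    by blast
  show ?case
  proof (cases "S \<subseteq> S'")
    case True
    then have "S = S'"
      by (auto simp: S'_def)
    with es show ?thesis
      by blast
  next
    case False
    then obtain w0 where w0: "w0 \<in> S" "w0 \<notin> S'"
      by blast
    obtain c0 where c0: "coords w0 c0"
      using insert.prems(3)[OF w0(1)] by (elim exE)
    then have c0n: "c0 n \<noteq> 0"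
      using w0 by (auto simp: S'_def)
    have es_S': "set es \<subseteq> S'"
      using es by (simp add: orthogonal_expansion_def)
    have S'_S: "S' \<subseteq> S" and S'_W: "S' \<subseteq> W"
      using insert.prems(1) by (auto simp: S'_def)
    define p where "p = (\<lambda>x. \<Sum>e\<leftarrow>es. (B w0 e / B e e) *\<^sub>R e x)"
    have p: "p \<in> S'"
      unfolding p_def by (rule sum_list_mem[OF S'_closed es_S'])
    define e0 where "e0 = residual es w0"
    have e0_S: "e0 \<in> S"
      unfolding e0_def using es_S' S'_S w0 by (intro residual_mem insert.prems(2)) auto
    have e0_W: "e0 \<in> W"
      using e0_S insert.prems(1) by blast
    have e0_ortho: "B e0 w = 0" if "w \<in> S'" for w
      unfolding e0_def using w0 insert.prems(1) by (intro residual_orthogonal[OF es S'_W _ that]) auto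
    \<comment> \<open>Multiples of \<open>e0\<close> correct the new coordinate of \<open>w\<close>, which brings it into \<open>S'\<close>.\<close>
    have expand: "B u w = (\<Sum>e\<leftarrow>e0 # es. B u e * B e w / B e e)" if u: "u \<in> W" and w: "w \<in> S" for u w
    proof -
      obtain c where c: "coords w c"
        using insert.prems(3)[OF w] by (elim exE)
      define r where "r = c n / c0 n"
      have "1 * c n + (- r) * c0 n = 0"
        using c0n by (simp add: r_def)
      with insert.prems(4)[OF w w0(1) c c0, of 1 "- r"] comb[OF w w0(1), of 1 "- r"]
      have "(\<lambda>x. 1 *\<^sub>R w x + (- r) *\<^sub>R w0 x) \<in> S'"
        unfolding S'_def by (intro CollectI conjI exI)
      from comb'[OF this p, of 1 r] have w1: "(\<lambda>x. 1 *\<^sub>R w x + (- r) *\<^sub>R e0 x) \<in> S'" (is "?w1 \<in> S'")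
        by (simp add: e0_def residual_def p_def algebra_simps)
      have wW: "w \<in> W" and w1W: "?w1 \<in> W"
        using w w1 insert.prems(1) S'_W by auto
      have "B u w - r * B u e0 = B u ?w1"
        using combination_right[OF wW e0_W u, of 1 "- r"] by simp
      also have "\<dots> = (\<Sum>e\<leftarrow>es. B u e * B e ?w1 / B e e)"
        using es u w1 by (simp only: orthogonal_expansion_def)
      also have "\<dots> = (\<Sum>e\<leftarrow>es. B u e * B e w / B e e)"
      proof (rule arg_cong[of _ _ sum_list], rule map_cong[OF refl])
        fix e
        assume "e \<in> set es"
        then have e: "e \<in> S'" "e \<in> W"
          using es_S' S'_W by auto
        have "B e ?w1 = B e w"
          using combination_right[OF wW e0_W e(2), of 1 "- r"] e0_ortho[OF e(1)] sym[OF e(2) e0_W]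
          by simp
        then show "B u e * B e ?w1 / B e e = B u e * B e w / B e e"
          by (simp only:)
      qed
      finally have "B u w = r * B u e0 + (\<Sum>e\<leftarrow>es. B u e * B e w / B e e)"
        by simp
      moreover have "r * B u e0 = B u e0 * B e0 w / B e0 e0"
      proof (cases "B e0 e0 = 0")
        case True
        then show ?thesis
          using null_orthogonal[OF u e0_W] by simp
      next
        case False
        have "B e0 w - r * B e0 e0 = 0"
          using combination_right[OF wW e0_W e0_W, of 1 "- r"] e0_ortho[OF w1] by simp
        with False show ?thesis
          by (simp add: field_simps)
      qed
      ultimately show ?thesis
        by simp
    qed
    have "set (e0 # es) \<subseteq> S"
      using e0_S es_S' S'_S by auto
    with expand have "orthogonal_expansion S (e0 # es)"
      by (simp only: orthogonal_expansion_def) blast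
    then show ?thesis ..
  qed
qed

text \<open>Differentiability in the seminorm of the form, which is all that the product rule asks for. For
  forms bounded by the norm of \<open>H(div)\<close> it follows from differentiability in \<open>H(div)\<close>.\<close>

definition has_curve_derivative ::
    "(real \<Rightarrow> 'a \<Rightarrow> 'b) \<Rightarrow> ('a \<Rightarrow> 'b) \<Rightarrow> real \<Rightarrow> real set \<Rightarrow> bool" where
  "has_curve_derivative u u' t T \<longleftrightarrow> (\<forall>s\<in>T. u s \<in> W) \<and> u' \<in> W \<and>
     ((\<lambda>s. B (\<lambda>x. (1 / (s - t)) *\<^sub>R (u s x - u t x) - u' x) (\<lambda>x. (1 / (s - t)) *\<^sub>R (u s x - u t x) - u' x))
       \<longlongrightarrow> 0) (at t within T)"

lemma has_curve_derivative_const: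
  assumes "w \<in> W"
  shows "has_curve_derivative (\<lambda>s. w) (\<lambda>x. 0) t T"
proof -
  have "(\<lambda>x. 0) \<in> W"
    using closed by (simp add: closed_under_combinations_def)
  with assms zero_left show ?thesis
    by (simp add: has_curve_derivative_def)
qed

text \<open>The difference quotient of \<open>B (u s) (v s)\<close> is \<open>B q (v t) + B (u t) r + (s - t) B q r\<close>, where \<open>q\<close> and \<open>r\<close> are
  the difference quotients of \<open>u\<close> and \<open>v\<close>. By the Cauchy-Schwarz inequality all three forms
  converge.\<close>

lemma has_real_derivative_product:
  assumes u: "has_curve_derivative u u' t T" and v: "has_curve_derivative v v' t T" and t: "t \<in> T"
  shows "((\<lambda>s. B (u s) (v s)) has_real_derivative B u' (v t) + B (u t) v') (at t within T)"
proof -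
  let ?q = "\<lambda>u s x. (1 / (s - t)) *\<^sub>R u s x + (- (1 / (s - t))) *\<^sub>R u t x"
  let ?d = "\<lambda>u u' s x. 1 *\<^sub>R ?q u s x + (- 1) *\<^sub>R u' x"
  have W: "u s \<in> W" "v s \<in> W" "u' \<in> W" "v' \<in> W" if "s \<in> T" for s
    using u v that by (auto simp: has_curve_derivative_def)
  note Wt = W(1,2)[OF t] W(3,4)[OF t]
  have qW: "?q u s \<in> W" "?q v s \<in> W" if "s \<in> T" for s
    using W[OF that] Wt by (intro combination_mem; simp)+
  have dW: "?d u u' s \<in> W" "?d v v' s \<in> W" if "s \<in> T" for s
    by (rule combination_mem[OF qW(1)[OF that] Wt(3)], rule combination_mem[OF qW(2)[OF that] Wt(4)])
  have small: "((\<lambda>s. sqrt (B (?d w w' s) (?d w w' s))) \<longlongrightarrow> 0) (at t within T)"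
    if "has_curve_derivative w w' t T" for w w'
  proof -
    have "(\<lambda>x. (1 / (s - t)) *\<^sub>R (w s x - w t x) - w' x) = ?d w w' s" for s
      by (simp add: fun_eq_iff scaleR_diff_right)
    then have "((\<lambda>s. B (?d w w' s) (?d w w' s)) \<longlongrightarrow> 0) (at t within T)"
      using that by (simp only: has_curve_derivative_def)
    from tendsto_real_sqrt[OF this] show ?thesis
      by simp
  qed
  have ev: "\<forall>\<^sub>F s in at t within T. s \<in> T \<and> s \<noteq> t"
    by (simp add: eventually_at_filter)
  have fixed: "((\<lambda>s. B (?q w s) z) \<longlongrightarrow> B w' z) (at t within T)"
    if w: "has_curve_derivative w w' t T" and z: "z \<in> W" for w w' z
  proof -
    have mem: "w s \<in> W" "w' \<in> W" "?q w s \<in> W" "?d w w' s \<in> W" if "s \<in> T" for s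
    proof -
      show *: "w s \<in> W" "w' \<in> W"
        using w that by (auto simp: has_curve_derivative_def)
      have "w t \<in> W"
        using w t by (auto simp: has_curve_derivative_def)
      with *(1) show q: "?q w s \<in> W"
        by (rule combination_mem)
      show "?d w w' s \<in> W"
        by (rule combination_mem[OF q *(2)])
    qed
    have "((\<lambda>s. B (?q w s) z - B w' z) \<longlongrightarrow> 0) (at t within T)"
    proof (rule Lim_null_comparison)
      show "((\<lambda>s. sqrt (B (?d w w' s) (?d w w' s)) * sqrt (B z z)) \<longlongrightarrow> 0) (at t within T)"
        using tendsto_mult_right[OF small[OF w], of "sqrt (B z z)"] by simp
      show "\<forall>\<^sub>F s in at t within T. norm (B (?q w s) z - B w' z) \<le> sqrt (B (?d w w' s) (?d w w' s)) * sqrt (B z z)"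
        using ev
      proof eventually_elim
        case (elim s)
        then have s: "s \<in> T" by simp
        have "B (?q w s) z - B w' z = B (?d w w' s) z"
          using combination_left[OF mem(3)[OF s] mem(2)[OF s] z, of 1 "- 1"] by simp
        then show ?case
          using Cauchy_Schwarz[OF mem(4)[OF s] z] by simp
      qed
    qed
    then show ?thesis
      by (simp add: Lim_null[symmetric])
  qed
  have both: "((\<lambda>s. B (?q u s) (?q v s)) \<longlongrightarrow> B u' v') (at t within T)"
  proof -
    have "((\<lambda>s. B (?d u u' s) (?d v v' s)) \<longlongrightarrow> 0) (at t within T)"
    proof (rule Lim_null_comparison)
      show "((\<lambda>s. sqrt (B (?d u u' s) (?d u u' s)) * sqrt (B (?d v v' s) (?d v v' s))) \<longlongrightarrow> 0) (at t within T)"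
        using tendsto_mult[OF small[OF u] small[OF v]] by simp
      show "\<forall>\<^sub>F s in at t within T. norm (B (?d u u' s) (?d v v' s))
          \<le> sqrt (B (?d u u' s) (?d u u' s)) * sqrt (B (?d v v' s) (?d v v' s))"
        using ev by eventually_elim (use dW Cauchy_Schwarz in auto)
    qed
    then have "((\<lambda>s. B (?d u u' s) (?d v v' s) + B (?q v s) u' + B (?q u s) v' - B u' v')
        \<longlongrightarrow> 0 + B v' u' + B u' v' - B u' v') (at t within T)"
      by (intro tendsto_intros fixed u v Wt)
    moreover have "\<forall>\<^sub>F s in at t within T. B (?d u u' s) (?d v v' s) + B (?q v s) u' + B (?q u s) v' - B u' v'
        = B (?q u s) (?q v s)"
      using ev
    proof eventually_elim
      case (elim s)
      then have s: "s \<in> T" by simp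
      have "B (?d u u' s) (?d v v' s) = B (?q u s) (?q v s) - B u' (?q v s) - B (?q u s) v' + B u' v'"
        using combination_left[OF qW(1)[OF s] Wt(3) dW(2)[OF s], of 1 "- 1"]
          combination_right[OF qW(2)[OF s] Wt(4) qW(1)[OF s], of 1 "- 1"]
          combination_right[OF qW(2)[OF s] Wt(4) Wt(3), of 1 "- 1"]
        by simp
      then show ?case
        using sym[OF qW(2)[OF s] Wt(3)] by simp
    qed
    ultimately have "((\<lambda>s. B (?q u s) (?q v s)) \<longlongrightarrow> 0 + B v' u' + B u' v' - B u' v') (at t within T)"
      by (rule Lim_transform_eventually)
    then show ?thesis
      using sym[OF Wt(4) Wt(3)] by simp
  qed
  have "((\<lambda>s. B (?q u s) (v t) + B (?q v s) (u t) + (s - t) * B (?q u s) (?q v s))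
      \<longlongrightarrow> B u' (v t) + B v' (u t) + (t - t) * B u' v') (at t within T)"
    by (intro tendsto_intros fixed both u v Wt)
  moreover have "\<forall>\<^sub>F s in at t within T.
      B (?q u s) (v t) + B (?q v s) (u t) + (s - t) * B (?q u s) (?q v s)
      = (B (u s) (v s) - B (u t) (v t)) / (s - t)"
    using ev
  proof eventually_elim
    case (elim s)
    then have s: "s \<in> T" and ne: "s - t \<noteq> 0" by auto
    let ?k = "1 / (s - t)"
    have 1: "B (?q u s) z = ?k * (B (u s) z - B (u t) z)" if "z \<in> W" for z
      using combination_left[OF W(1)[OF s] Wt(1) that, of ?k "- ?k"] by (simp add: diff_divide_distrib)
    have 2: "B (?q v s) z = ?k * (B z (v s) - B z (v t))" if "z \<in> W" for z
      using combination_left[OF W(2)[OF s] Wt(2) that, of ?k "- ?k"] sym[OF that W(2)[OF s]] sym[OF that Wt(2)]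
      by (simp add: diff_divide_distrib)
    have 3: "B (?q u s) (?q v s)
        = ?k * (?k * (B (u s) (v s) - B (u s) (v t)) - ?k * (B (u t) (v s) - B (u t) (v t)))"
      using 1[OF qW(2)[OF s]] 2[OF W(1)[OF s]] 2[OF Wt(1)] sym[OF qW(2)[OF s] W(1)[OF s]] sym[OF qW(2)[OF s] Wt(1)]
      by simp
    have "1 / h * (a - d) + 1 / h * (b - d) + h * (1 / h * (1 / h * (e - a) - 1 / h * (b - d))) = (e - d) / h"
      if "h \<noteq> 0" for a b d e h :: real
      using that by (simp add: field_simps)
    then show ?case
      unfolding 1[OF Wt(2)] 2[OF Wt(1)] 3 using ne by blast
  qed
  ultimately have "((\<lambda>s. (B (u s) (v s) - B (u t) (v t)) / (s - t))
      \<longlongrightarrow> B u' (v t) + B v' (u t) + (t - t) * B u' v') (at t within T)"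
    by (rule Lim_transform_eventually)
  then show ?thesis
    using sym[OF Wt(4) Wt(1)] by (simp add: has_field_derivative_iff)
qed

text \<open>The form is \<open>B (u s) (v s)\<close> minus a finite combination of products \<open>B (u s) e * B e (v s)\<close> with fixed
  fields \<open>e\<close>.\<close>

lemma has_real_derivative_residual_product:
  assumes u: "has_curve_derivative u u' t T" and v: "has_curve_derivative v v' t T" and t: "t \<in> T"
    and es: "set es \<subseteq> W"
  shows "((\<lambda>s. B (residual es (u s)) (v s)) has_real_derivative
    B (residual es u') (v t) + B (residual es (u t)) v') (at t within T)"
proof -
  have W: "u s \<in> W" "v s \<in> W" "u' \<in> W" "v' \<in> W" if "s \<in> T" for s
    using u v that by (auto simp: has_curve_derivative_def)
  have zero: "B w (\<lambda>x. 0) = 0" "B (\<lambda>x. 0) w = 0" if "w \<in> W" for w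
    using combination_right[of w w w 0 0] zero_left[of w] that by simp_all
  have sum: "((\<lambda>s. \<Sum>e\<leftarrow>es. B (u s) e * B e (v s) / B e e) has_real_derivative
      (\<Sum>e\<leftarrow>es. B u' e * B e (v t) / B e e) + (\<Sum>e\<leftarrow>es. B (u t) e * B e v' / B e e)) (at t within T)"
    using es
  proof (induction es)
    case (Cons e es)
    then have e: "e \<in> W"
      by simp
    have 1: "((\<lambda>s. B (u s) e) has_real_derivative B u' e) (at t within T)"
      using has_real_derivative_product[OF u has_curve_derivative_const[OF e] t] zero W[OF t] by simp
    have 2: "((\<lambda>s. B e (v s)) has_real_derivative B e v') (at t within T)"
      using has_real_derivative_product[OF has_curve_derivative_const[OF e] v t] zero W[OF t] by simp
    have "((\<lambda>s. B (u s) e * B e (v s) / B e e) has_real_derivative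
        B u' e * B e (v t) / B e e + B (u t) e * B e v' / B e e) (at t within T)"
      using DERIV_cdivide[OF DERIV_mult[OF 1 2], of "B e e"]
      by (simp add: add_divide_distrib mult.commute)
    from DERIV_add[OF this Cons.IH] Cons.prems show ?case
      by (simp add: algebra_simps)
  qed simp
  have "((\<lambda>s. B (u s) (v s) - (\<Sum>e\<leftarrow>es. B (u s) e * B e (v s) / B e e)) has_real_derivative
      B (residual es u') (v t) + B (residual es (u t)) v') (at t within T)"
    using DERIV_diff[OF has_real_derivative_product[OF u v t] sum] W[OF t] es
    by (simp add: residual_left algebra_simps)
  then show ?thesis
    by (rule has_field_derivative_transform_within[where d = 1]) (use t W es residual_left in auto)
qed

end

section \<open>The inner product weighted by the depth\<close>

lemma L2_closed: "closed_under_combinations (L2 \<Omega>)"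
  by (auto simp: closed_under_combinations_def intro: L2_zero L2_add L2_scaleR)

lemma semi_inner_space_subset:
  assumes "semi_inner_space W B" "S \<subseteq> W" "closed_under_combinations S"
  shows "semi_inner_space S B"
proof -
  interpret semi_inner_space W B by fact
  show ?thesis
  proof
    show "B (\<lambda>x. a *\<^sub>R u x + b *\<^sub>R v x) w = a * B u w + b * B v w"
      if "u \<in> S" "v \<in> S" "w \<in> S" for u v w a b
      using that assms(2) by (intro combination_left) auto
    show "B u v = B v u" if "u \<in> S" "v \<in> S" for u v
      using that assms(2) by (intro sym) auto
    show "0 \<le> B u u" if "u \<in> S" for u
      using that assms(2) by (intro nonneg) auto
  qed (rule assms(3))
qed

lemma integral_weight_nonneg:
  assumes "AE x in M. 0 \<le> k x"
  shows "0 \<le> (\<integral>x. k x * (norm (g x))\<^sup>2 \<partial>M :: real)"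
  using assms by (intro integral_nonneg_AE) auto

locale layer =
  fixes \<Omega> :: "(real ^ 2) set" and H :: "real ^ 2 \<Rightarrow> real" and Hlo Hhi :: real
  assumes bounded: "bounded \<Omega>" and open_domain: "open \<Omega>"
    and H_measurable: "H \<in> borel_measurable (lebesgue_on \<Omega>)" and Hlo: "0 < Hlo"
    and H_bounds: "AE x in lebesgue_on \<Omega>. Hlo \<le> H x \<and> H x \<le> Hhi"
begin

text \<open>The inner product \<open>(1/H \<cdot>, \<cdot>)\<close>, for scalar and vector fields alike.\<close>

definition wform :: "(real ^ 2 \<Rightarrow> 'b::euclidean_space) \<Rightarrow> (real ^ 2 \<Rightarrow> 'b) \<Rightarrow> real" where
  "wform u v = L2_inner \<Omega> (\<lambda>x. (1 / H x) *\<^sub>R u x) v"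

lemma H_pos: "AE x in lebesgue_on \<Omega>. 0 < H x"
  using H_bounds by eventually_elim (use Hlo in auto)

lemma recip_bound: "AE x in lebesgue_on \<Omega>. \<bar>1 / H x\<bar> \<le> 1 / Hlo"
  using H_bounds by eventually_elim (use Hlo in \<open>auto simp: frac_le\<close>)

lemma recip_L2: "u \<in> L2 \<Omega> \<Longrightarrow> (\<lambda>x. (1 / H x) *\<^sub>R u x) \<in> L2 \<Omega>"
  using recip_bound H_measurable by (intro L2_bounded_multiple) auto

lemma wform_eq: "wform u v = (\<integral>x. (u x \<bullet> v x) / H x \<partial>lebesgue_on \<Omega>)"
  by (simp add: wform_def L2_inner_def)

lemma wform_integrable: "u \<in> L2 \<Omega> \<Longrightarrow> v \<in> L2 \<Omega> \<Longrightarrow> integrable (lebesgue_on \<Omega>) (\<lambda>x. (u x \<bullet> v x) / H x)"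
  using L2_integrable_inner[OF recip_L2, of u v] by simp

lemma semi_inner_space_wform:
  "semi_inner_space (L2 \<Omega> :: (real ^ 2 \<Rightarrow> 'b::euclidean_space) set) wform"
proof
  fix u v w :: "real ^ 2 \<Rightarrow> 'b" and a b :: real
  show "wform u v = wform v u"
    by (simp add: wform_eq inner_commute)
  show "0 \<le> wform u u"
    unfolding wform_eq using H_pos by (intro integral_nonneg_AE) auto
  assume "u \<in> L2 \<Omega>" "v \<in> L2 \<Omega>" "w \<in> L2 \<Omega>"
  then have "wform (\<lambda>x. a *\<^sub>R u x + b *\<^sub>R v x) w
      = (\<integral>x. a * ((u x \<bullet> w x) / H x) + b * ((v x \<bullet> w x) / H x) \<partial>lebesgue_on \<Omega>)"
    unfolding wform_eq
    by (intro Bochner_Integration.integral_cong) (auto simp: inner_add_left add_divide_distrib)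
  also have "\<dots> = a * wform u w + b * wform v w"
    using Bochner_Integration.integral_add[OF
        integrable_mult_right[OF wform_integrable[OF \<open>u \<in> L2 \<Omega>\<close> \<open>w \<in> L2 \<Omega>\<close>], of a]
        integrable_mult_right[OF wform_integrable[OF \<open>v \<in> L2 \<Omega>\<close> \<open>w \<in> L2 \<Omega>\<close>], of b]]
    by (simp only: wform_eq integral_mult_right_zero)
  finally show "wform (\<lambda>x. a *\<^sub>R u x + b *\<^sub>R v x) w = a * wform u w + b * wform v w" .
qed (rule L2_closed)

lemma weighted_norm_recip: "weighted_norm \<Omega> (\<lambda>x. 1 / H x) u = sqrt (wform u u)"
  by (simp add: weighted_norm_def wform_eq power2_norm_eq_inner)

lemma wform_Cauchy_Schwarz:
  assumes "u \<in> L2 \<Omega>" "v \<in> L2 \<Omega>"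
  shows "\<bar>wform u v\<bar> \<le> weighted_norm \<Omega> (\<lambda>x. 1 / H x) u * weighted_norm \<Omega> (\<lambda>x. 1 / H x) v"
  unfolding weighted_norm_recip using semi_inner_space.Cauchy_Schwarz[OF semi_inner_space_wform assms] .

lemma wform_nonneg: "0 \<le> wform u u"
  unfolding wform_eq using H_pos by (intro integral_nonneg_AE) auto

lemma wform_le_L2: 
  assumes "u \<in> L2 \<Omega>"
  shows "wform u u \<le> 1 / Hlo * L2_inner \<Omega> u u"
proof -
  have "wform u u \<le> (\<integral>x. 1 / Hlo * (u x \<bullet> u x) \<partial>lebesgue_on \<Omega>)"
    unfolding wform_eq
  proof (rule integral_mono_AE)
    show "AE x in lebesgue_on \<Omega>. u x \<bullet> u x / H x \<le> 1 / Hlo * (u x \<bullet> u x)"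
      using H_bounds by eventually_elim (use Hlo in \<open>simp add: frac_le\<close>)
  qed (intro integrable_mult_right wform_integrable L2_integrable_inner assms)+
  then show ?thesis
    by (simp only: L2_inner_def integral_mult_right_zero)
qed

lemma wform_mono_pointwise:
  assumes "u \<in> L2 \<Omega>" "v \<in> L2 \<Omega>" "AE x in lebesgue_on \<Omega>. norm (u x) \<le> M * norm (v x)" "0 \<le> M"
  shows "weighted_norm \<Omega> (\<lambda>x. 1 / H x) u \<le> M * weighted_norm \<Omega> (\<lambda>x. 1 / H x) v"
proof -
  have "wform u u \<le> (\<integral>x. M\<^sup>2 * ((v x \<bullet> v x) / H x) \<partial>lebesgue_on \<Omega>)"
    unfolding wform_eq
  proof (rule integral_mono_AE)
    show "AE x in lebesgue_on \<Omega>. u x \<bullet> u x / H x \<le> M\<^sup>2 * ((v x \<bullet> v x) / H x)"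
      using assms(3) H_pos
    proof eventually_elim
      case (elim x)
      then have "(norm (u x))\<^sup>2 \<le> (M * norm (v x))\<^sup>2"
        by (intro power_mono) auto
      then have "u x \<bullet> u x / H x \<le> M\<^sup>2 * (v x \<bullet> v x) / H x"
        using elim by (intro divide_right_mono) (simp_all add: power2_norm_eq_inner power_mult_distrib)
      then show ?case
        by simp
    qed
  qed (intro integrable_mult_right wform_integrable assms)+
  then have "wform u u \<le> M\<^sup>2 * wform v v"
    by (simp only: wform_eq integral_mult_right_zero)
  from real_sqrt_le_mono[OF this] show ?thesis
    using assms(4) by (simp add: weighted_norm_recip real_sqrt_mult)
qed

text \<open>The weights \<open>H\<close> and \<open>1/H\<close> are dual to each other: \<open>(F, v) = (1/H (H F), v)\<close>, and the \<open>1/H\<close>-norm of \<open>H F\<close> is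
  the \<open>H\<close>-norm of \<open>F\<close>.\<close>

lemma L2_inner_dual_bound:
  assumes "F \<in> L2 \<Omega>" "v \<in> L2 \<Omega>"
  shows "\<bar>L2_inner \<Omega> F v\<bar> \<le> weighted_norm \<Omega> H F * weighted_norm \<Omega> (\<lambda>x. 1 / H x) v"
proof -
  have HF: "(\<lambda>x. H x *\<^sub>R F x) \<in> L2 \<Omega>"
  proof (rule L2_bounded_multiple[OF assms(1) H_measurable])
    show "AE x in lebesgue_on \<Omega>. \<bar>H x\<bar> \<le> Hhi"
      using H_bounds by eventually_elim (use Hlo in auto)
  qed
  have "L2_inner \<Omega> F v = wform (\<lambda>x. H x *\<^sub>R F x) v"
    unfolding wform_def
  proof (rule L2_inner_cong_AE)
    show "AE x in lebesgue_on \<Omega>. F x = (1 / H x) *\<^sub>R H x *\<^sub>R F x"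
      using H_pos by eventually_elim auto
  qed (intro AE_I2 refl recip_L2 HF assms)+
  moreover have "weighted_norm \<Omega> (\<lambda>x. 1 / H x) (\<lambda>x. H x *\<^sub>R F x) = weighted_norm \<Omega> H F"
    unfolding weighted_norm_def
  proof (intro arg_cong[of _ _ sqrt] integral_cong_AE)
    show "AE x in lebesgue_on \<Omega>. 1 / H x * (norm (H x *\<^sub>R F x))\<^sup>2 = H x * (norm (F x))\<^sup>2"
      using H_pos by eventually_elim (simp add: power2_eq_square)
  qed (use assms H_measurable in \<open>auto simp: L2_def\<close>)
  ultimately show ?thesis
    using wform_Cauchy_Schwarz[OF HF assms(2)] by simp
qed

lemma damping_bound:
  assumes "u \<in> L2 \<Omega>" "C \<in> borel_measurable (lebesgue_on \<Omega>)" "AE x in lebesgue_on \<Omega>. Clo \<le> C x \<and> C x \<le> Chi"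
    and "0 < Clo"
  shows "Clo * wform u u \<le> L2_inner \<Omega> (\<lambda>x. (C x / H x) *\<^sub>R u x) u"
proof -
  have Cu: "(\<lambda>x. C x *\<^sub>R u x) \<in> L2 \<Omega>"
  proof (rule L2_bounded_multiple[OF assms(1,2)])
    show "AE x in lebesgue_on \<Omega>. \<bar>C x\<bar> \<le> Chi"
      using assms(3) by eventually_elim (use assms(4) in auto)
  qed
  have "Clo * wform u u = (\<integral>x. Clo * ((u x \<bullet> u x) / H x) \<partial>lebesgue_on \<Omega>)"
    by (simp only: wform_eq integral_mult_right_zero)
  also have "\<dots> \<le> (\<integral>x. (C x *\<^sub>R u x \<bullet> u x) / H x \<partial>lebesgue_on \<Omega>)"
  proof (rule integral_mono_AE)
    show "AE x in lebesgue_on \<Omega>. Clo * ((u x \<bullet> u x) / H x) \<le> (C x *\<^sub>R u x \<bullet> u x) / H x"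
      using assms(3) H_pos
    proof eventually_elim
      case (elim x)
      then have "Clo * ((u x \<bullet> u x) / H x) \<le> C x * ((u x \<bullet> u x) / H x)"
        by (intro mult_right_mono) auto
      then show ?case
        by simp
    qed
  qed (intro integrable_mult_right wform_integrable assms Cu)+
  finally show ?thesis
    by (simp add: L2_inner_def)
qed

lemma semi_inner_space_div:
  assumes "W \<subseteq> Hdiv0 \<Omega>" "closed_under_combinations W"
  shows "semi_inner_space W (\<lambda>u v. L2_inner \<Omega> (wdiv \<Omega> u) (wdiv \<Omega> v))"
proof
  fix u v w a b
  show "L2_inner \<Omega> (wdiv \<Omega> u) (wdiv \<Omega> v) = L2_inner \<Omega> (wdiv \<Omega> v) (wdiv \<Omega> u)"
    by (rule L2_inner_commute)
  show "0 \<le> L2_inner \<Omega> (wdiv \<Omega> u) (wdiv \<Omega> u)"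
    by (rule L2_inner_nonneg)
  assume "u \<in> W" "v \<in> W" "w \<in> W"
  then have u: "u \<in> Hdiv \<Omega>" and v: "v \<in> Hdiv \<Omega>" and w: "w \<in> Hdiv \<Omega>"
    using assms(1) by (auto simp: Hdiv0_def)
  have "L2_inner \<Omega> (wdiv \<Omega> (\<lambda>x. a *\<^sub>R u x + b *\<^sub>R v x)) (wdiv \<Omega> w)
      = L2_inner \<Omega> (\<lambda>x. a *\<^sub>R wdiv \<Omega> u x + b *\<^sub>R wdiv \<Omega> v x) (wdiv \<Omega> w)"
    by (intro L2_inner_cong_AE wdiv_combination[OF bounded open_domain] AE_I2 refl wdiv_L2
        Hdiv_combination[OF bounded open_domain] L2_add L2_scaleR u v w)
  also have "\<dots> = a * L2_inner \<Omega> (wdiv \<Omega> u) (wdiv \<Omega> w) + b * L2_inner \<Omega> (wdiv \<Omega> v) (wdiv \<Omega> w)"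
    using L2_scaleR[OF wdiv_L2[OF u], of a] L2_scaleR[OF wdiv_L2[OF v], of b] wdiv_L2[OF w]
    by (simp only: L2_inner_add_left L2_inner_scaleR_left)
  finally show "L2_inner \<Omega> (wdiv \<Omega> (\<lambda>x. a *\<^sub>R u x + b *\<^sub>R v x)) (wdiv \<Omega> w)
      = a * L2_inner \<Omega> (wdiv \<Omega> u) (wdiv \<Omega> w) + b * L2_inner \<Omega> (wdiv \<Omega> v) (wdiv \<Omega> w)" .
qed (rule assms(2))

lemma Hdiv0_L2: "Hdiv0 \<Omega> \<subseteq> L2 \<Omega>"
  by (auto simp: Hdiv0_def Hdiv_def)

lemma has_time_derivative_imp_curve_derivative:
  assumes S: "semi_inner_space W B" and W: "W \<subseteq> Hdiv0 \<Omega>"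
    and bound: "\<And>w. w \<in> W \<Longrightarrow> B w w \<le> M * (Hdiv_norm \<Omega> w)\<^sup>2"
    and u: "\<And>s. 0 \<le> s \<Longrightarrow> u s \<in> W" "has_time_derivative \<Omega> W u u' t" and t: "0 \<le> t"
  shows "semi_inner_space.has_curve_derivative W B u u' t {0..}"
proof -
  interpret semi_inner_space W B by fact
  let ?d = "\<lambda>s x. (1 / (s - t)) *\<^sub>R (u s x - u t x) - u' x"
  have u': "u' \<in> W" and lim: "((\<lambda>s. Hdiv_norm \<Omega> (?d s)) \<longlongrightarrow> 0) (at t within {0..})"
    using u(2) by (auto simp: has_time_derivative_def)
  have d: "?d s \<in> W" if "s \<ge> 0" for s
  proof -
    have "(\<lambda>x. (1 / (s - t)) *\<^sub>R u s x + (- (1 / (s - t))) *\<^sub>R u t x) \<in> W"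
      by (intro combination_mem u t that)
    from combination_mem[OF this u', of 1 "- 1"] show ?thesis
      by (simp add: scaleR_diff_right)
  qed
  have "((\<lambda>s. B (?d s) (?d s)) \<longlongrightarrow> 0) (at t within {0..})"
  proof (rule tendsto_sandwich)
    show "\<forall>\<^sub>F s in at t within {0..}. 0 \<le> B (?d s) (?d s)"
      using d nonneg by (auto simp: eventually_at_filter)
    show "\<forall>\<^sub>F s in at t within {0..}. B (?d s) (?d s) \<le> M * (Hdiv_norm \<Omega> (?d s))\<^sup>2"
      using d bound by (auto simp: eventually_at_filter)
    show "((\<lambda>s. M * (Hdiv_norm \<Omega> (?d s))\<^sup>2) \<longlongrightarrow> 0) (at t within {0..})"
      using tendsto_mult_left[OF tendsto_power[OF lim, of 2], of M] by simp
  qed simp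
  then show ?thesis
    using u u' by (simp add: has_curve_derivative_def)
qed

lemma Hdiv_norm_sq: "(Hdiv_norm \<Omega> u)\<^sup>2 = L2_inner \<Omega> u u + L2_inner \<Omega> (wdiv \<Omega> u) (wdiv \<Omega> u)"
  by (simp add: Hdiv_norm_def L2_norm_def L2_inner_nonneg)

end

lemma norm_perp: "norm (perp u) = norm u"
  by (simp add: perp_def norm_vec_def L2_set_def UNIV_2 power2_eq_square add.commute)

lemma inner_perp: "perp u \<bullet> u = 0"
  by (simp add: perp_def inner_vec_def UNIV_2 mult.commute)

lemma perp_measurable: "u \<in> borel_measurable M \<Longrightarrow> (\<lambda>x. perp (u x)) \<in> borel_measurable M"
proof -
  have "continuous_on UNIV perp"
  proof -
    have eq: "perp = (\<lambda>u. \<chi> i. if i = 1 then - (u $ 2) else u $ 1)"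
      by (auto simp: fun_eq_iff vec_eq_iff perp_def forall_2)
    have "continuous_on UNIV (\<lambda>u::real^2. if i = 1 then - (u $ 2) else u $ 1)" for i :: 2
      by (cases "i = 1") (auto intro!: continuous_intros)
    then show ?thesis
      unfolding eq by (rule continuous_on_vec_lambda)
  qed
  then show "u \<in> borel_measurable M \<Longrightarrow> (\<lambda>x. perp (u x)) \<in> borel_measurable M"
    by (rule borel_measurable_continuous_on)
qed

section \<open>The discrete Helmholtz decomposition\<close>

context layer
begin

lemma wform_null:
  assumes "AE x in lebesgue_on \<Omega>. u x = 0"
  shows "wform u u = 0"
  unfolding wform_eq
proof (rule integral_eq_zero_AE)
  show "AE x in lebesgue_on \<Omega>. u x \<bullet> u x / H x = 0"
    using assms by eventually_elim simp
qed

lemma div_free_closed: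
  assumes W: "W \<subseteq> Hdiv0 \<Omega>" "closed_under_combinations W"
  shows "closed_under_combinations {w \<in> W. div_free \<Omega> w}"
proof -
  have comb: "div_free \<Omega> (\<lambda>x. a *\<^sub>R u x + b *\<^sub>R v x)"
    if "u \<in> W" "v \<in> W" "a = 0 \<or> div_free \<Omega> u" "b = 0 \<or> div_free \<Omega> v" for u v a b
  proof -
    have "AE x in lebesgue_on \<Omega>. a * wdiv \<Omega> u x = 0" "AE x in lebesgue_on \<Omega>. b * wdiv \<Omega> v x = 0"
      using that(3,4) by (auto simp: div_free_def)
    moreover have "AE x in lebesgue_on \<Omega>. wdiv \<Omega> (\<lambda>x. a *\<^sub>R u x + b *\<^sub>R v x) x = a *\<^sub>R wdiv \<Omega> u x + b *\<^sub>R wdiv \<Omega> v x"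
      using that(1,2) W(1) by (intro wdiv_combination[OF bounded open_domain]) (auto simp: Hdiv0_def)
    ultimately show ?thesis
      unfolding div_free_def by eventually_elim auto
  qed
  have zero: "(\<lambda>x. 0) \<in> W"
    using W(2) by (simp add: closed_under_combinations_def)
  have "div_free \<Omega> (\<lambda>x. 0)"
    using comb[OF zero zero, of 0 0] by simp
  with zero comb show ?thesis
    unfolding closed_under_combinations_def
    by (simp add: closed_under_combinationsD[OF W(2)])
qed

lemma semi_inner_space_wform_on:
  assumes "W \<subseteq> Hdiv0 \<Omega>" "closed_under_combinations W"
  shows "semi_inner_space W wform"
  using assms Hdiv0_L2 by (intro semi_inner_space_subset[OF semi_inner_space_wform]) auto

lemma div_free_orthogonal_expansion:
  fixes I :: "'i set"
  assumes W: "W \<subseteq> Hdiv0 \<Omega>" "closed_under_combinations W" and I: "finite I"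
    and rep: "\<And>v. v \<in> W \<Longrightarrow> \<exists>c. AE x in lebesgue_on \<Omega>. v x = (\<Sum>i\<in>I. c i *\<^sub>R b i x)"
  shows "\<exists>es. semi_inner_space.orthogonal_expansion W wform {w \<in> W. div_free \<Omega> w} es"
proof -
  interpret semi_inner_space W wform
    by (rule semi_inner_space_wform_on[OF W])
  show ?thesis
  proof (rule finite_dim_orthogonal_expansion[OF I,
        where coords = "\<lambda>u c. AE x in lebesgue_on \<Omega>. u x = (\<Sum>i\<in>I. c i *\<^sub>R b i x)"])
    show "closed_under_combinations {w \<in> W. div_free \<Omega> w}"
      by (rule div_free_closed[OF W])
    show "\<exists>c. AE x in lebesgue_on \<Omega>. u x = (\<Sum>i\<in>I. c i *\<^sub>R b i x)" if "u \<in> {w \<in> W. div_free \<Omega> w}" for u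
      using that by (intro rep) simp
    show "AE x in lebesgue_on \<Omega>. p *\<^sub>R u x + q *\<^sub>R v x = (\<Sum>i\<in>I. (p * c i + q * d i) *\<^sub>R b i x)"
      if c: "AE x in lebesgue_on \<Omega>. u x = (\<Sum>i\<in>I. c i *\<^sub>R b i x)"
        and d: "AE x in lebesgue_on \<Omega>. v x = (\<Sum>i\<in>I. d i *\<^sub>R b i x)" for u v c d p q
      using c d by eventually_elim (simp add: scaleR_sum_right scaleR_add_left sum.distrib)
    show "wform u u = 0"
      if u: "AE x in lebesgue_on \<Omega>. u x = (\<Sum>i\<in>I. c i *\<^sub>R b i x)" and c: "\<forall>i\<in>I. c i = 0" for u c
    proof (rule wform_null)
      show "AE x in lebesgue_on \<Omega>. u x = 0"
        using u by eventually_elim (simp add: c)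
    qed
  qed auto
qed

lemma residual_helmholtz:
  assumes W: "W \<subseteq> Hdiv0 \<Omega>" "closed_under_combinations W"
    and es: "semi_inner_space.orthogonal_expansion W wform {w \<in> W. div_free \<Omega> w} es" and u: "u \<in> W"
  shows residual_in_space: "semi_inner_space.residual wform es u \<in> W"
    and residual_helmholtz_decomposition: "\<exists>uS. helmholtz_decomposition \<Omega> H W u (semi_inner_space.residual wform es u) uS"
    and residual_wdiv: "AE x in lebesgue_on \<Omega>. wdiv \<Omega> (semi_inner_space.residual wform es u) x = wdiv \<Omega> u x"
proof -
  interpret semi_inner_space W wform
    by (rule semi_inner_space_wform_on[OF W])
  let ?S = "{w \<in> W. div_free \<Omega> w}"
  let ?uS = "\<lambda>x. \<Sum>e\<leftarrow>es. (wform u e / wform e e) *\<^sub>R e x"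
  have es_S: "set es \<subseteq> ?S"
    using es by (simp add: orthogonal_expansion_def)
  have uS: "?uS \<in> ?S"
    by (rule sum_list_mem[OF div_free_closed[OF W] es_S])
  show R: "residual es u \<in> W"
    using es_S by (intro residual_mem W(2) u) auto
  have "helmholtz_decomposition \<Omega> H W u (residual es u) ?uS"
    unfolding helmholtz_decomposition_def
  proof (intro conjI ballI impI R)
    show "?uS \<in> W" "div_free \<Omega> ?uS"
      using uS by auto
    show "AE x in lebesgue_on \<Omega>. u x = residual es u x + ?uS x"
      by (simp add: residual_def)
    show "L2_inner \<Omega> (\<lambda>x. (1 / H x) *\<^sub>R residual es u x) w = 0" if "w \<in> W" "div_free \<Omega> w" for w
      using residual_orthogonal[OF es _ u, of w] that by (simp add: wform_def subset_iff)
  qed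
  then show "\<exists>uS. helmholtz_decomposition \<Omega> H W u (residual es u) uS"
    by (rule exI[of _ ?uS])
  have "AE x in lebesgue_on \<Omega>. wdiv \<Omega> (residual es u) x = 1 *\<^sub>R wdiv \<Omega> u x + (- 1) *\<^sub>R wdiv \<Omega> ?uS x"
    unfolding residual_eq using u uS W(1)
    by (intro wdiv_combination[OF bounded open_domain]) (auto simp: Hdiv0_def)
  moreover have "AE x in lebesgue_on \<Omega>. wdiv \<Omega> ?uS x = 0"
    using uS by (simp add: div_free_def)
  ultimately show "AE x in lebesgue_on \<Omega>. wdiv \<Omega> (residual es u) x = wdiv \<Omega> u x"
    by eventually_elim simp
qed

text \<open>Subtracting a divergence-free field leaves the divergence unchanged, so that the
  Poincare-Friedrichs inequality bounds \<open>u\<^sup>D\<close> by the divergence of \<open>u\<close> itself.\<close>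

lemma residual_poincare:
  assumes W: "W \<subseteq> Hdiv0 \<Omega>" "closed_under_combinations W"
    and es: "semi_inner_space.orthogonal_expansion W wform {w \<in> W. div_free \<Omega> w} es" and u: "u \<in> W"
    and CP: "poincare_friedrichs \<Omega> H W CP" "0 < CP"
  shows "weighted_norm \<Omega> (\<lambda>x. 1 / H x) (semi_inner_space.residual wform es u)
    \<le> CP / sqrt Hlo * L2_norm \<Omega> (wdiv \<Omega> u)"
proof -
  let ?R = "semi_inner_space.residual wform es u"
  have u_div: "wdiv \<Omega> u \<in> L2 \<Omega>" and R_div: "wdiv \<Omega> ?R \<in> L2 \<Omega>"
    using u residual_in_space[OF W es u] W(1) by (auto simp: Hdiv0_def intro: wdiv_L2)
  have "weighted_norm \<Omega> (\<lambda>x. 1 / H x) ?R \<le> CP * weighted_norm \<Omega> (\<lambda>x. 1 / H x) (wdiv \<Omega> ?R)"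
    using CP(1) u residual_helmholtz_decomposition[OF W es u] by (auto simp: poincare_friedrichs_def)
  also have "weighted_norm \<Omega> (\<lambda>x. 1 / H x) (wdiv \<Omega> ?R) = sqrt (wform (wdiv \<Omega> u) (wdiv \<Omega> u))"
  proof -
    have "AE x in lebesgue_on \<Omega>. (1 / H x) *\<^sub>R wdiv \<Omega> ?R x = (1 / H x) *\<^sub>R wdiv \<Omega> u x"
      using residual_wdiv[OF W es u] by eventually_elim simp
    then have "wform (wdiv \<Omega> ?R) (wdiv \<Omega> ?R) = wform (wdiv \<Omega> u) (wdiv \<Omega> u)"
      unfolding wform_def[of "wdiv \<Omega> ?R"] wform_def[of "wdiv \<Omega> u"]
      by (intro L2_inner_cong_AE[OF _ residual_wdiv[OF W es u]] recip_L2 u_div R_div)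
    then show ?thesis
      by (simp add: weighted_norm_recip)
  qed
  also have "\<dots> \<le> sqrt (1 / Hlo * L2_inner \<Omega> (wdiv \<Omega> u) (wdiv \<Omega> u))"
    by (intro real_sqrt_le_mono wform_le_L2 u_div)
  also have "\<dots> = L2_norm \<Omega> (wdiv \<Omega> u) / sqrt Hlo"
    by (simp add: L2_norm_def real_sqrt_divide)
  finally show ?thesis
    using CP(2) by (simp add: mult.commute)
qed

text \<open>Rotation and damping are bounded together: the field \<open>f/\<epsilon> w\<^sup>\<perp> + C w\<close> has pointwise length at most
  \<open>(1/\<epsilon> + C\<^sup>*) |w|\<close>.\<close>

lemma rotation_damping_bound:
  assumes w: "w \<in> L2 \<Omega>" and v: "v \<in> L2 \<Omega>" and "0 < \<epsilon>" "0 \<le> Clo" "0 \<le> Chi"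
    and f: "f \<in> borel_measurable (lebesgue_on \<Omega>)" "AE x in lebesgue_on \<Omega>. \<bar>f x\<bar> \<le> 1"
    and C: "C \<in> borel_measurable (lebesgue_on \<Omega>)" "AE x in lebesgue_on \<Omega>. Clo \<le> C x \<and> C x \<le> Chi"
  shows "\<bar>1 / \<epsilon> * L2_inner \<Omega> (\<lambda>x. (f x / H x) *\<^sub>R perp (w x)) v + L2_inner \<Omega> (\<lambda>x. (C x / H x) *\<^sub>R w x) v\<bar>
    \<le> (1 / \<epsilon> + Chi) * weighted_norm \<Omega> (\<lambda>x. 1 / H x) w * weighted_norm \<Omega> (\<lambda>x. 1 / H x) v"
proof -
  have C_abs: "AE x in lebesgue_on \<Omega>. \<bar>C x\<bar> \<le> Chi"
    using C(2) by eventually_elim (use assms(4) in auto)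
  have "(\<lambda>x. perp (w x)) \<in> L2 \<Omega>"
    using w by (simp add: L2_def norm_perp perp_measurable)
  then have fw: "(\<lambda>x. f x *\<^sub>R perp (w x)) \<in> L2 \<Omega>"
    by (rule L2_bounded_multiple[OF _ f])
  have Cw: "(\<lambda>x. C x *\<^sub>R w x) \<in> L2 \<Omega>"
    by (rule L2_bounded_multiple[OF w C(1) C_abs])
  let ?A = "\<lambda>x. (1 / \<epsilon>) *\<^sub>R (f x *\<^sub>R perp (w x)) + 1 *\<^sub>R (C x *\<^sub>R w x)"
  have A: "?A \<in> L2 \<Omega>"
    by (intro L2_add L2_scaleR fw Cw)
  have "weighted_norm \<Omega> (\<lambda>x. 1 / H x) ?A \<le> (1 / \<epsilon> + Chi) * weighted_norm \<Omega> (\<lambda>x. 1 / H x) w"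
  proof (rule wform_mono_pointwise[OF A w])
    show "AE x in lebesgue_on \<Omega>. norm (?A x) \<le> (1 / \<epsilon> + Chi) * norm (w x)"
      using f(2) C_abs
    proof eventually_elim
      case (elim x)
      have "norm (?A x) \<le> 1 / \<epsilon> * (\<bar>f x\<bar> * norm (w x)) + \<bar>C x\<bar> * norm (w x)"
        using norm_triangle_ineq[of "(1 / \<epsilon>) *\<^sub>R (f x *\<^sub>R perp (w x))" "1 *\<^sub>R (C x *\<^sub>R w x)"] \<open>0 < \<epsilon>\<close>
        by (simp add: norm_perp)
      also have "\<dots> \<le> 1 / \<epsilon> * (1 * norm (w x)) + Chi * norm (w x)"
        using elim \<open>0 < \<epsilon>\<close> by (intro add_mono mult_left_mono mult_right_mono) auto
      finally show ?case
        by (simp add: distrib_right)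
    qed
    show "0 \<le> 1 / \<epsilon> + Chi"
      using assms(3,5) by simp
  qed
  moreover have "0 \<le> weighted_norm \<Omega> (\<lambda>x. 1 / H x) v"
    by (simp add: weighted_norm_recip wform_nonneg)
  ultimately have bound: "weighted_norm \<Omega> (\<lambda>x. 1 / H x) ?A * weighted_norm \<Omega> (\<lambda>x. 1 / H x) v
      \<le> (1 / \<epsilon> + Chi) * weighted_norm \<Omega> (\<lambda>x. 1 / H x) w * weighted_norm \<Omega> (\<lambda>x. 1 / H x) v"
    by (rule mult_right_mono)
  have "wform ?A v = 1 / \<epsilon> * wform (\<lambda>x. f x *\<^sub>R perp (w x)) v + 1 * wform (\<lambda>x. C x *\<^sub>R w x) v"
    by (rule semi_inner_space.combination_left[OF semi_inner_space_wform fw Cw v])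
  also have "wform (\<lambda>x. f x *\<^sub>R perp (w x)) v = L2_inner \<Omega> (\<lambda>x. (f x / H x) *\<^sub>R perp (w x)) v"
    by (simp add: wform_def)
  also have "wform (\<lambda>x. C x *\<^sub>R w x) v = L2_inner \<Omega> (\<lambda>x. (C x / H x) *\<^sub>R w x) v"
    by (simp add: wform_def)
  finally show ?thesis
    using wform_Cauchy_Schwarz[OF A v] bound by simp
qed

end

text \<open>Serves to derive relations between constants, such as \<open>C\<^sub>* \<le> C\<^sup>*\<close>, from bounds that hold almost
  everywhere.\<close>

lemma AE_lebesgue_on_open_nonempty:
  assumes "open \<Omega>" "\<Omega> \<noteq> {}" "AE x in lebesgue_on \<Omega>. P"
  shows P
proof (rule ccontr)
  assume "\<not> P"
  have "AE x in lebesgue. x \<in> \<Omega> \<longrightarrow> P"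
    using assms by (simp add: AE_restrict_space_iff)
  then have "AE x in lebesgue. x \<notin> \<Omega>"
    by eventually_elim (use \<open>\<not> P\<close> in auto)
  then have "negligible \<Omega>"
    using assms(1) by (simp add: negligible_iff_null_sets AE_iff_null_sets)
  with open_not_negligible assms show False
    by blast
qed

section \<open>Decay of the modified energy\<close>

lemma exponential_weight_integrable:
  fixes \<psi> :: "real \<Rightarrow> real"
  assumes "\<psi> integrable_on {0..t}" "\<And>s. s \<in> {0..t} \<Longrightarrow> 0 \<le> \<psi> s"
  shows "(\<lambda>s. exp (k * s) * \<psi> s) integrable_on {0..t}"
proof -
  have "(\<lambda>s. exp (k * s) * \<psi> s) absolutely_integrable_on {0..t}"
  proof (rule absolutely_integrable_bounded_measurable_product_real)
    have "continuous_on {0..t} (\<lambda>s. exp (k * s))"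
      by (intro continuous_intros)
    then show "bounded ((\<lambda>s. exp (k * s)) ` {0..t})"
      by (intro compact_imp_bounded compact_continuous_image) auto
    show "(\<lambda>s. exp (k * s)) \<in> borel_measurable (lebesgue_on {0..t})"
      by (intro continuous_imp_measurable_on_sets_lebesgue continuous_intros) auto
    show "\<psi> absolutely_integrable_on {0..t}"
      using assms by (intro nonnegative_absolutely_integrable_1) auto
  qed auto
  then show ?thesis
    by (simp add: absolutely_integrable_on_def)
qed

text \<open>The integrating factor \<open>exp (k s)\<close> turns the differential inequality into a bound for a
  derivative. The Henstock-Kurzweil integral recovers a function from any everywhere defined
  derivative, so the bound can be integrated although \<open>\<psi>\<close> is only integrable in time.\<close>

lemma damped_Gronwall:
  fixes G G' \<psi> :: "real \<Rightarrow> real"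
  assumes deriv: "\<And>s. s \<ge> 0 \<Longrightarrow> (G has_real_derivative G' s) (at s within {0..})"
    and bound: "\<And>s. s \<ge> 0 \<Longrightarrow> G' s \<le> - k * G s + r * \<psi> s"
    and \<psi>: "\<psi> integrable_on {0..t}" "\<And>s. s \<in> {0..t} \<Longrightarrow> 0 \<le> \<psi> s" and t: "t \<ge> 0"
  shows "G t \<le> exp (- k * t) * G 0 + r * integral {0..t} (\<lambda>s. exp (k * (s - t)) * \<psi> s)"
proof -
  let ?g = "\<lambda>s. exp (k * s) * (k * G s + G' s)"
  have "((\<lambda>s. exp (k * s) * G s) has_vector_derivative ?g s) (at s within {0..t})" if "s \<in> {0..t}" for s
  proof -
    have "(G has_real_derivative G' s) (at s within {0..t})"
      using deriv[of s] that by (auto intro: has_field_derivative_subset)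
    then have "((\<lambda>s. exp (k * s) * G s) has_real_derivative ?g s) (at s within {0..t})"
      by (auto intro!: derivative_eq_intros simp: algebra_simps)
    then show ?thesis
      by (simp add: has_real_derivative_iff_has_vector_derivative)
  qed
  then have int: "(?g has_integral (exp (k * t) * G t - exp (k * 0) * G 0)) {0..t}"
    by (rule fundamental_theorem_of_calculus[OF t])
  have "((\<lambda>s. r * (exp (k * s) * \<psi> s)) has_integral r * integral {0..t} (\<lambda>s. exp (k * s) * \<psi> s)) {0..t}"
    by (intro has_integral_mult_right integrable_integral exponential_weight_integrable \<psi>)
  with int have "exp (k * t) * G t - exp (k * 0) * G 0 \<le> r * integral {0..t} (\<lambda>s. exp (k * s) * \<psi> s)"
  proof (rule has_integral_le)
    show "?g s \<le> r * (exp (k * s) * \<psi> s)" if "s \<in> {0..t}" for s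
    proof -
      have "?g s \<le> exp (k * s) * (r * \<psi> s)"
        using bound[of s] that by (intro mult_left_mono) auto
      then show ?thesis
        by (simp add: mult_ac)
    qed
  qed
  then have *: "exp (k * t) * G t \<le> G 0 + r * integral {0..t} (\<lambda>s. exp (k * s) * \<psi> s)"
    by simp
  have shift: "exp (- k * t) * integral {0..t} (\<lambda>s. exp (k * s) * \<psi> s)
      = integral {0..t} (\<lambda>s. exp (k * (s - t)) * \<psi> s)"
  proof -
    have "exp (k * (s - t)) = exp (- k * t) * exp (k * s)" for s
      by (simp add: exp_add[symmetric] right_diff_distrib)
    then show ?thesis
      by (simp add: mult.assoc)
  qed
  have "G t = exp (- k * t) * (exp (k * t) * G t)"
    by (simp add: exp_minus)
  also have "\<dots> \<le> exp (- k * t) * (G 0 + r * integral {0..t} (\<lambda>s. exp (k * s) * \<psi> s))"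
    using * by (rule mult_left_mono) simp
  also have "\<dots> = exp (- k * t) * G 0 + r * (exp (- k * t) * integral {0..t} (\<lambda>s. exp (k * s) * \<psi> s))"
    by (simp add: algebra_simps)
  finally show ?thesis
    unfolding shift .
qed

text \<open>The pointwise inequality behind \<open>G' \<le> - \<alpha>/3 G + 5/(12 \<alpha>) \<phi>\<^sup>2\<close>. Here \<open>p\<close> stands for \<open>(1/H u\<^sub>t, u\<^sup>D)\<close>, \<open>pD\<close>
  for \<open>(1/H u\<^sub>t, u\<^sub>t\<^sup>D)\<close>, \<open>cross\<close> for rotation and damping tested with \<open>u\<^sup>D\<close>, and \<open>work\<close> for the forcing
  tested with \<open>u\<^sub>t + \<alpha>/3 u\<^sup>D\<close>. After Young's inequality for \<open>work\<close>, everything is \<open>\<alpha>\<close> times a quadratic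
  form in \<open>X\<close> and \<open>Y\<close>, whose coefficients depend on \<open>m\<close> alone.\<close>

lemma energy_decay_algebra:
  fixes X Y \<phi> \<alpha> c m p pD cross damp work Clo :: real
  assumes nonneg: "X \<ge> 0" "Y \<ge> 0" "\<phi> \<ge> 0" "\<alpha> > 0" "c \<ge> 0" "m \<ge> 0"
    and \<alpha>c: "\<alpha> * c \<le> 1 / 2" and Clo: "\<alpha> * (3 + m\<^sup>2) / 2 \<le> Clo"
    and damp: "Clo * X\<^sup>2 \<le> damp" and p: "\<bar>p\<bar> \<le> c * X * Y" and pD: "pD \<le> X\<^sup>2"
    and cross: "\<bar>cross\<bar> \<le> m * X * Y" and work: "work \<le> \<phi> * (X + \<alpha> / 3 * c * Y)"
  shows "- damp + \<alpha> / 3 * (pD - cross - Y\<^sup>2) + work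
    \<le> - (\<alpha> / 3) * ((X\<^sup>2 + Y\<^sup>2) / 2 + \<alpha> / 3 * p) + 5 / (12 * \<alpha>) * \<phi>\<^sup>2"
proof -
  define N where "N = X + Y / 6"
  have XY: "0 \<le> X * Y"
    using nonneg by simp
  have "\<alpha> * p \<le> \<alpha> * (c * X * Y)"
    using p nonneg by (intro mult_left_mono) auto
  also have "\<dots> = (\<alpha> * c) * (X * Y)"
    by simp
  also have "\<dots> \<le> 1 / 2 * (X * Y)"
    using \<alpha>c XY by (rule mult_right_mono)
  finally have p': "\<alpha> * (\<alpha> * p) \<le> \<alpha> * (X * Y / 2)"
    using nonneg by (intro mult_left_mono) auto
  have "\<alpha> * c * Y \<le> 1 / 2 * Y"
    using \<alpha>c nonneg(2) by (rule mult_right_mono)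
  moreover have "\<alpha> / 3 * c * Y = \<alpha> * c * Y / 3"
    by simp
  ultimately have "X + \<alpha> / 3 * c * Y \<le> N"
    unfolding N_def by linarith
  then have "\<phi> * (X + \<alpha> / 3 * c * Y) \<le> \<phi> * N"
    using nonneg(3) by (rule mult_left_mono)
  with work have work': "work \<le> \<phi> * N"
    by simp
  \<comment> \<open>The weight \<open>5/12\<close> is what the comparison of \<open>G\<close> with \<open>E\<close> allows: \<open>6/5 \<cdot> 5/12 = 1/2\<close>.\<close>
  have young: "\<phi> * N \<le> 5 / (12 * \<alpha>) * \<phi>\<^sup>2 + 3 * \<alpha> / 5 * N\<^sup>2"
  proof -
    have "0 \<le> (5 * \<phi> - 6 * \<alpha> * N)\<^sup>2 / (60 * \<alpha>)"
      using nonneg by simp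
    also have "\<dots> = 5 / (12 * \<alpha>) * \<phi>\<^sup>2 + 3 * \<alpha> / 5 * N\<^sup>2 - \<phi> * N"
      using nonneg by (simp add: power2_eq_square field_simps)
    finally show ?thesis by simp
  qed
  have "\<alpha> * (3 + m\<^sup>2) / 2 * X\<^sup>2 \<le> Clo * X\<^sup>2"
    using Clo by (rule mult_right_mono) simp
  with damp have damp': "\<alpha> * ((3 + m\<^sup>2) / 2 * X\<^sup>2) \<le> damp"
    by simp
  have pD': "\<alpha> * pD \<le> \<alpha> * X\<^sup>2" and cross': "\<alpha> * (- cross) \<le> \<alpha> * (m * X * Y)"
    using pD cross nonneg by (intro mult_left_mono; simp)+
  \<comment> \<open>Complete the square in \<open>Y\<close>; what is left as coefficient of \<open>X\<^sup>2\<close> is a positive quadratic in \<open>m\<close>.\<close>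
  have form: "0 \<le> (m\<^sup>2 / 2 + 2 / 5) * X\<^sup>2 - (m / 3 + 23 / 90) * (X * Y) + 3 / 20 * Y\<^sup>2"
  proof -
    have "(m\<^sup>2 / 2 + 2 / 5) * X\<^sup>2 - (m / 3 + 23 / 90) * (X * Y) + 3 / 20 * Y\<^sup>2
      = 3 / 20 * (Y - 10 / 3 * (m / 3 + 23 / 90) * X)\<^sup>2
        + (m\<^sup>2 / 2 + 2 / 5 - 5 / 3 * (m / 3 + 23 / 90)\<^sup>2) * X\<^sup>2"
      by (simp add: power2_eq_square field_simps)
    moreover have "0 \<le> m\<^sup>2 / 2 + 2 / 5 - 5 / 3 * (m / 3 + 23 / 90)\<^sup>2"
    proof -
      have "m\<^sup>2 / 2 + 2 / 5 - 5 / 3 * (m / 3 + 23 / 90)\<^sup>2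
        = 17 / 54 * (m - 23 / 51)\<^sup>2 + (2 / 5 - 529 / 4860 - 17 / 54 * (23 / 51)\<^sup>2)"
        by (simp add: power2_eq_square field_simps)
      then show ?thesis
        by (simp add: power2_eq_square)
    qed
    ultimately show ?thesis
      by simp
  qed
  have "0 \<le> \<alpha> * ((m\<^sup>2 / 2 + 2 / 5) * X\<^sup>2 - (m / 3 + 23 / 90) * (X * Y) + 3 / 20 * Y\<^sup>2)"
    using form nonneg by simp
  moreover have "\<alpha> * ((m\<^sup>2 / 2 + 2 / 5) * X\<^sup>2 - (m / 3 + 23 / 90) * (X * Y) + 3 / 20 * Y\<^sup>2)
    = \<alpha> * ((3 + m\<^sup>2) / 2 * X\<^sup>2) - \<alpha> / 3 * X\<^sup>2 - \<alpha> * (m * X * Y) / 3 + \<alpha> / 3 * Y\<^sup>2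
      - \<alpha> / 3 * ((X\<^sup>2 + Y\<^sup>2) / 2) - \<alpha> * (X * Y / 2) / 9 - 3 * \<alpha> / 5 * N\<^sup>2"
    by (simp add: N_def power2_eq_square field_simps)
  ultimately have "- damp + \<alpha> * X\<^sup>2 / 3 + \<alpha> * (m * X * Y) / 3 - \<alpha> / 3 * Y\<^sup>2
      + \<alpha> / 3 * ((X\<^sup>2 + Y\<^sup>2) / 2) + \<alpha> * (X * Y / 2) / 9 + 3 * \<alpha> / 5 * N\<^sup>2 \<le> 0"
    using damp' by simp
  moreover have "- damp + \<alpha> / 3 * (pD - cross - Y\<^sup>2) + \<alpha> / 3 * ((X\<^sup>2 + Y\<^sup>2) / 2 + \<alpha> / 3 * p)
     = - damp + \<alpha> * pD / 3 + \<alpha> * (- cross) / 3 - \<alpha> / 3 * Y\<^sup>2 + \<alpha> / 3 * ((X\<^sup>2 + Y\<^sup>2) / 2)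
       + \<alpha> * (\<alpha> * p) / 9"
    by (simp add: field_simps)
  ultimately show ?thesis
    using p' work' young pD' cross' by linarith
qed

theorem theorem4p7:
  fixes \<Omega> :: "(real ^ 2) set"
    and H f C :: "real ^ 2 \<Rightarrow> real"
    and F :: "real \<Rightarrow> real ^ 2 \<Rightarrow> real ^ 2"
    and Vh :: "(real ^ 2 \<Rightarrow> real ^ 2) set"
    and u ut utt :: "real \<Rightarrow> real ^ 2 \<Rightarrow> real ^ 2"
    and \<epsilon> \<beta> Hlo Hhi Clo Chi CP \<alpha> \<alpha>1 \<alpha>2 chi K t :: real
    and E :: "real \<Rightarrow> real"
  assumes domain: "open \<Omega>" "connected \<Omega>" "\<Omega> \<noteq> {}" "bounded \<Omega>"
    and constants: "\<epsilon> > 0" "\<beta> > 0"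
    and H: "H \<in> borel_measurable (lebesgue_on \<Omega>)" "0 < Hlo"
      "AE x in lebesgue_on \<Omega>. Hlo \<le> H x \<and> H x \<le> Hhi"
    and f: "f \<in> borel_measurable (lebesgue_on \<Omega>)" "AE x in lebesgue_on \<Omega>. \<bar>f x\<bar> \<le> 1"
    and C: "C \<in> borel_measurable (lebesgue_on \<Omega>)" "0 < Clo"
      "AE x in lebesgue_on \<Omega>. Clo \<le> C x \<and> C x \<le> Chi"
    and F: "\<And>s. s \<ge> 0 \<Longrightarrow> F s \<in> L2 \<Omega>"
      "\<And>T. T \<ge> 0 \<Longrightarrow> (\<lambda>s. (weighted_norm \<Omega> H (F s))\<^sup>2) integrable_on {0..T}"
    and Vh: "mixed_fe_space \<Omega> Vh"
    and CP: "CP > 0" "poincare_friedrichs \<Omega> H Vh CP" "poincare_friedrichs \<Omega> H (Hdiv0 \<Omega>) CP"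
    and curve: "\<And>s. s \<ge> 0 \<Longrightarrow> u s \<in> Vh"
      "\<And>s. s \<ge> 0 \<Longrightarrow> has_time_derivative \<Omega> Vh u (ut s) s"
      "\<And>s. s \<ge> 0 \<Longrightarrow> has_time_derivative \<Omega> Vh ut (utt s) s"
    and solution: "\<And>s v. s \<ge> 0 \<Longrightarrow> v \<in> Vh \<Longrightarrow>
        L2_inner \<Omega> (\<lambda>x. (1 / H x) *\<^sub>R utt s x) v
        + 1 / \<epsilon> * L2_inner \<Omega> (\<lambda>x. (f x / H x) *\<^sub>R perp (ut s x)) v
        + \<beta> / \<epsilon>\<^sup>2 * L2_inner \<Omega> (wdiv \<Omega> (u s)) (wdiv \<Omega> v)
        + L2_inner \<Omega> (\<lambda>x. (C x / H x) *\<^sub>R ut s x) v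
        = L2_inner \<Omega> (F s) v"
    and E: "\<And>s. E s = energy \<Omega> H \<beta> \<epsilon> (u s) (ut s)"
    and \<alpha>1: "\<alpha>1 = sqrt (\<beta> * Hlo) / (2 * CP * \<epsilon>)"
    and chi: "chi = 2 + CP\<^sup>2 * (1 + \<epsilon> * Chi)\<^sup>2 / (\<beta> * Hlo)"
    and \<alpha>2: "\<alpha>2 = 2 * Clo / (1 + chi)"
    and \<alpha>: "0 < \<alpha>" "\<alpha> \<le> min \<alpha>1 \<alpha>2"
    and K: "K = 1 / 2 * (1 + \<alpha>\<^sup>2 * CP\<^sup>2 * \<epsilon>\<^sup>2 / (\<beta> * Hlo\<^sup>2))"
    and t: "t \<ge> 0"
  shows "E t \<le> 3 * exp (- (\<alpha> / 3) * t) * E 0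
    + K / \<alpha> * integral {0..t} (\<lambda>s. exp (\<alpha> / 3 * (s - t)) * (weighted_norm \<Omega> H (F s))\<^sup>2)"
proof -
  interpret layer \<Omega> H Hlo Hhi
    by unfold_locales (use domain H in auto)
  have W: "Vh \<subseteq> Hdiv0 \<Omega>" "closed_under_combinations Vh"
    using mixed_fe_space_Hdiv0[OF Vh] mixed_fe_space_closed[OF domain(4,1) Vh] .
  interpret B: semi_inner_space Vh wform
    by (rule semi_inner_space_wform_on[OF W])
  let ?D = "\<lambda>u v. L2_inner \<Omega> (wdiv \<Omega> u) (wdiv \<Omega> v)"
  interpret D: semi_inner_space Vh ?D
    by (rule semi_inner_space_div[OF W])
  have in_Vh: "u s \<in> Vh" "ut s \<in> Vh" "utt s \<in> Vh" if "s \<ge> 0" for s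
    using curve[OF that] by (auto simp: has_time_derivative_def)
  have in_L2: "v \<in> L2 \<Omega>" and div_L2: "wdiv \<Omega> v \<in> L2 \<Omega>" if "v \<in> Vh" for v
    using that W(1) by (auto simp: Hdiv0_def intro: Hdiv_L2 wdiv_L2)

  \<comment> \<open>\<open>Q\<close> is the map \<open>u \<mapsto> u\<^sup>D\<close> on \<open>Vh\<close>, given by a finite list of divergence-free fields.\<close>
  obtain I :: "((real ^ 2) set \<times> 2 option \<times> nat \<times> nat) set" and b where I: "finite I"
    and b: "\<forall>v\<in>Vh. \<exists>c. AE x in lebesgue_on \<Omega>. v x = (\<Sum>i\<in>I. c i *\<^sub>R b i x)"
    using mixed_fe_space_finite_dim[OF domain(1) Vh] by (elim exE conjE)
  have "\<exists>es. B.orthogonal_expansion {w \<in> Vh. div_free \<Omega> w} es"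
    by (rule div_free_orthogonal_expansion[OF W I bspec[OF b]])
  then obtain es where es: "B.orthogonal_expansion {w \<in> Vh. div_free \<Omega> w} es"
    by (elim exE)
  then have es_Vh: "set es \<subseteq> Vh"
    unfolding B.orthogonal_expansion_def by blast
  define Q where "Q = B.residual es"
  have Q_Vh: "Q v \<in> Vh" if "v \<in> Vh" for v
    unfolding Q_def by (rule residual_in_space[OF W es that])

  have curve_B: "B.has_curve_derivative u (ut s) s {0..}" "B.has_curve_derivative ut (utt s) s {0..}"
    and curve_D: "D.has_curve_derivative u (ut s) s {0..}" if s: "s \<ge> 0" for s
  proof -
    have B_bound: "wform w w \<le> 1 / Hlo * (Hdiv_norm \<Omega> w)\<^sup>2" if "w \<in> Vh" for w
    proof -
      have "wform w w \<le> 1 / Hlo * L2_inner \<Omega> w w"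
        by (rule wform_le_L2[OF in_L2[OF that]])
      also have "\<dots> \<le> 1 / Hlo * (Hdiv_norm \<Omega> w)\<^sup>2"
        using Hlo by (intro mult_left_mono) (auto simp: Hdiv_norm_sq L2_inner_nonneg)
      finally show ?thesis .
    qed
    have D_bound: "?D w w \<le> 1 * (Hdiv_norm \<Omega> w)\<^sup>2" if "w \<in> Vh" for w
      by (simp add: Hdiv_norm_sq L2_inner_nonneg)
    show "B.has_curve_derivative u (ut s) s {0..}"
      by (rule has_time_derivative_imp_curve_derivative[OF B.semi_inner_space_axioms W(1) B_bound in_Vh(1) curve(2)[OF s] s])
    show "B.has_curve_derivative ut (utt s) s {0..}"
      by (rule has_time_derivative_imp_curve_derivative[OF B.semi_inner_space_axioms W(1) B_bound in_Vh(2) curve(3)[OF s] s])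
    show "D.has_curve_derivative u (ut s) s {0..}"
      by (rule has_time_derivative_imp_curve_derivative[OF D.semi_inner_space_axioms W(1) D_bound in_Vh(1) curve(2)[OF s] s])
  qed

  define X where "X s = weighted_norm \<Omega> (\<lambda>x. 1 / H x) (ut s)" for s
  define Y where "Y s = sqrt \<beta> / \<epsilon> * L2_norm \<Omega> (wdiv \<Omega> (u s))" for s
  define \<phi> where "\<phi> s = weighted_norm \<Omega> H (F s)" for s
  define p where "p s = wform (Q (u s)) (ut s)" for s
  define c where "c = CP * \<epsilon> / sqrt (\<beta> * Hlo)"
  define m where "m = c * (1 / \<epsilon> + Chi)"
  define G where "G s = E s + \<alpha> / 3 * p s" for s
  have X_sq: "(X s)\<^sup>2 = wform (ut s) (ut s)" for s
    by (simp add: X_def weighted_norm_recip wform_nonneg)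
  have Y_sq: "(Y s)\<^sup>2 = \<beta> / \<epsilon>\<^sup>2 * ?D (u s) (u s)" for s
    using constants by (simp add: Y_def L2_norm_def L2_inner_nonneg power_mult_distrib power_divide)
  have E_XY: "E s = ((X s)\<^sup>2 + (Y s)\<^sup>2) / 2" for s
    by (simp add: E energy_def X_def Y_sq L2_norm_def L2_inner_nonneg field_simps)
  have Chi: "Clo \<le> Chi"
    by (rule AE_lebesgue_on_open_nonempty[OF domain(1,3)]) (use C(3) in eventually_elim, simp)
  have pos: "0 < \<beta> * Hlo" "0 < sqrt (\<beta> * Hlo)"
    using constants Hlo by simp_all
  have X_nonneg: "0 \<le> X s" for s
    by (simp add: X_def weighted_norm_recip wform_nonneg)
  have Y_nonneg: "0 \<le> Y s" for s
    using constants by (simp add: Y_def L2_norm_def L2_inner_nonneg)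
  have \<phi>_nonneg: "0 \<le> \<phi> s" for s
    unfolding \<phi>_def weighted_norm_def
    by (intro real_sqrt_ge_zero integral_weight_nonneg, use H_pos in eventually_elim) simp
  have c_nonneg: "0 \<le> c"
    using CP(1) constants Hlo pos by (simp add: c_def)
  have m_nonneg: "0 \<le> m"
    using c_nonneg constants Chi C(2) by (simp add: m_def)
  have \<alpha>c: "\<alpha> * c \<le> 1 / 2"
  proof -
    have "\<alpha> * c \<le> \<alpha>1 * c"
      using \<alpha>(2) c_nonneg by (intro mult_right_mono) auto
    also have "\<dots> = 1 / 2"
      using CP(1) constants Hlo pos by (simp add: \<alpha>1 c_def)
    finally show ?thesis .
  qed
  have m_sq: "m\<^sup>2 = chi - 2"
  proof -
    have "\<epsilon> * (1 / \<epsilon> + Chi) = 1 + \<epsilon> * Chi"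
      using constants by (simp add: field_simps)
    moreover have "m = CP * (\<epsilon> * (1 / \<epsilon> + Chi)) / sqrt (\<beta> * Hlo)"
      by (simp add: m_def c_def)
    ultimately have "m = CP * (1 + \<epsilon> * Chi) / sqrt (\<beta> * Hlo)"
      by simp
    with pos show ?thesis
      by (simp add: chi power_divide power_mult_distrib)
  qed
  have \<alpha>_Clo: "\<alpha> * (3 + m\<^sup>2) / 2 \<le> Clo"
  proof -
    have "0 < 1 + chi"
      using m_sq zero_le_power2[of m] by linarith
    moreover have "\<alpha> \<le> 2 * Clo / (1 + chi)"
      using \<alpha>(2) by (simp add: \<alpha>2)
    ultimately show ?thesis
      by (simp add: m_sq field_simps)
  qed
  have Q_norm: "weighted_norm \<Omega> (\<lambda>x. 1 / H x) (Q (u s)) \<le> c * Y s" if "s \<ge> 0" for s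
  proof -
    have "c * Y s = CP / sqrt Hlo * L2_norm \<Omega> (wdiv \<Omega> (u s))"
      using constants by (simp add: c_def Y_def real_sqrt_mult)
    then show ?thesis
      using residual_poincare[OF W es in_Vh(1)[OF that] CP(2,1)] by (simp add: Q_def)
  qed
  have p_bound: "\<bar>p s\<bar> \<le> c * X s * Y s" if s: "s \<ge> 0" for s
  proof -
    have "\<bar>p s\<bar> \<le> weighted_norm \<Omega> (\<lambda>x. 1 / H x) (Q (u s)) * X s"
      unfolding p_def X_def using in_Vh[OF s] Q_Vh by (intro wform_Cauchy_Schwarz in_L2)
    also have "\<dots> \<le> c * Y s * X s"
      using Q_norm[OF s] X_nonneg by (rule mult_right_mono)
    finally show ?thesis
      by (simp add: mult_ac)
  qed

  define G' where "G' s = 1 / 2 * (wform (utt s) (ut s) + wform (ut s) (utt s))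
    + \<beta> / (2 * \<epsilon>\<^sup>2) * (?D (ut s) (u s) + ?D (u s) (ut s))
    + \<alpha> / 3 * (wform (Q (ut s)) (ut s) + wform (Q (u s)) (utt s))" for s
  have G_deriv: "(G has_real_derivative G' s) (at s within {0..})" if s: "s \<ge> 0" for s
  proof -
    have s': "s \<in> {0..}"
      using s by simp
    have E_forms: "E r = 1 / 2 * wform (ut r) (ut r) + \<beta> / (2 * \<epsilon>\<^sup>2) * ?D (u r) (u r)" for r
      by (simp add: E_XY X_sq Y_sq field_simps)
    show ?thesis
      unfolding G_def[abs_def] G'_def E_forms p_def Q_def
      by (intro DERIV_add DERIV_cmult B.has_real_derivative_product D.has_real_derivative_product
          B.has_real_derivative_residual_product curve_B curve_D s s' es_Vh)
  qed
  have G'_bound: "G' s \<le> - (\<alpha> / 3) * G s + 5 / (12 * \<alpha>) * (\<phi> s)\<^sup>2" if s: "s \<ge> 0" for s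
  proof -
    note mem = in_Vh[OF s]
    have Qu: "Q (u s) \<in> Vh" and Qut: "Q (ut s) \<in> Vh"
      using mem Q_Vh by auto
    define damp where "damp = L2_inner \<Omega> (\<lambda>x. (C x / H x) *\<^sub>R ut s x) (ut s)"
    define cross where "cross = 1 / \<epsilon> * L2_inner \<Omega> (\<lambda>x. (f x / H x) *\<^sub>R perp (ut s x)) (Q (u s))
      + L2_inner \<Omega> (\<lambda>x. (C x / H x) *\<^sub>R ut s x) (Q (u s))"
    define work where "work = L2_inner \<Omega> (F s) (ut s) + \<alpha> / 3 * L2_inner \<Omega> (F s) (Q (u s))"
    \<comment> \<open>The velocity is orthogonal to its rotation, which leaves the energy identity.\<close>
    have "L2_inner \<Omega> (\<lambda>x. (f x / H x) *\<^sub>R perp (ut s x)) (ut s) = 0"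
      by (simp add: L2_inner_def inner_perp)
    then have test_ut: "wform (utt s) (ut s) + \<beta> / \<epsilon>\<^sup>2 * ?D (u s) (ut s) + damp = L2_inner \<Omega> (F s) (ut s)"
      using solution[OF s mem(2)] by (simp add: wform_def damp_def)
    \<comment> \<open>Testing with \<open>u\<^sup>D\<close> recovers the potential energy, because \<open>u\<close> and \<open>u\<^sup>D\<close> have the same divergence.\<close>
    have "?D (u s) (Q (u s)) = ?D (u s) (u s)"
      unfolding Q_def
      by (rule L2_inner_cong_AE[OF AE_I2[OF refl] residual_wdiv[OF W es mem(1)]])
        (intro div_L2 mem residual_in_space[OF W es mem(1)])+
    then have test_Qu: "wform (utt s) (Q (u s)) + cross + (Y s)\<^sup>2 = L2_inner \<Omega> (F s) (Q (u s))"
      using solution[OF s Qu] by (simp add: wform_def cross_def Y_sq)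
    have "G' s = wform (utt s) (ut s) + \<beta> / \<epsilon>\<^sup>2 * ?D (u s) (ut s)
        + \<alpha> / 3 * (wform (Q (ut s)) (ut s) + wform (utt s) (Q (u s)))"
      using B.sym[OF mem(2,3)] D.sym[OF mem(1,2)] B.sym[OF Qu mem(3)] by (simp add: G'_def field_simps)
    also have "\<dots> = - damp + \<alpha> / 3 * (wform (Q (ut s)) (ut s) - cross - (Y s)\<^sup>2) + work"
    proof -
      have 1: "wform (utt s) (ut s) + \<beta> / \<epsilon>\<^sup>2 * ?D (u s) (ut s) = L2_inner \<Omega> (F s) (ut s) - damp"
        using test_ut by simp
      have 2: "wform (utt s) (Q (u s)) = L2_inner \<Omega> (F s) (Q (u s)) - cross - (Y s)\<^sup>2"
        using test_Qu by simp
      show ?thesis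
        unfolding 1 2 work_def by (simp add: algebra_simps)
    qed
    also have "\<dots> \<le> - (\<alpha> / 3) * (((X s)\<^sup>2 + (Y s)\<^sup>2) / 2 + \<alpha> / 3 * p s) + 5 / (12 * \<alpha>) * (\<phi> s)\<^sup>2"
    proof (rule energy_decay_algebra[OF X_nonneg Y_nonneg \<phi>_nonneg \<alpha>(1) c_nonneg m_nonneg \<alpha>c \<alpha>_Clo])
      show "Clo * (X s)\<^sup>2 \<le> damp"
        unfolding X_sq damp_def by (rule damping_bound[OF in_L2[OF mem(2)] C(1,3,2)])
      show "\<bar>p s\<bar> \<le> c * X s * Y s"
        by (rule p_bound[OF s])
      \<comment> \<open>A projection does not increase the norm: the subtracted Parseval sum has nonnegative terms.\<close>
      show "wform (Q (ut s)) (ut s) \<le> (X s)\<^sup>2"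
      proof -
        have "0 \<le> (\<Sum>e\<leftarrow>es. wform (ut s) e * wform e (ut s) / wform e e)"
        proof (rule sum_list_nonneg)
          fix r
          assume "r \<in> set (map (\<lambda>e. wform (ut s) e * wform e (ut s) / wform e e) es)"
          then obtain e where e: "e \<in> Vh" "r = wform (ut s) e * wform e (ut s) / wform e e"
            using es_Vh by auto
          then show "0 \<le> r"
            using B.sym[OF e(1) mem(2)] wform_nonneg[of e] by simp
        qed
        then show ?thesis
          by (simp add: Q_def X_sq B.residual_left[OF es_Vh mem(2,2)])
      qed
      show "\<bar>cross\<bar> \<le> m * X s * Y s"
      proof -
        have "\<bar>cross\<bar> \<le> (1 / \<epsilon> + Chi) * X s * weighted_norm \<Omega> (\<lambda>x. 1 / H x) (Q (u s))"
          unfolding cross_def X_def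
          by (rule rotation_damping_bound[OF in_L2[OF mem(2)] in_L2[OF Qu] constants(1) _ _ f C(1,3)])
            (use C(2) Chi in auto)
        also have "\<dots> \<le> (1 / \<epsilon> + Chi) * X s * (c * Y s)"
          using constants C(2) Chi X_nonneg by (intro mult_left_mono Q_norm[OF s]) auto
        finally show ?thesis
          by (simp add: m_def mult_ac)
      qed
      show "work \<le> \<phi> s * (X s + \<alpha> / 3 * c * Y s)"
      proof -
        have F_s: "F s \<in> L2 \<Omega>"
          by (rule F(1)[OF s])
        have "L2_inner \<Omega> (F s) (ut s) \<le> \<phi> s * X s"
          using L2_inner_dual_bound[OF F_s in_L2[OF mem(2)]] by (simp add: \<phi>_def X_def)
        moreover have "L2_inner \<Omega> (F s) (Q (u s)) \<le> \<phi> s * (c * Y s)"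
        proof -
          have "L2_inner \<Omega> (F s) (Q (u s)) \<le> \<phi> s * weighted_norm \<Omega> (\<lambda>x. 1 / H x) (Q (u s))"
            using L2_inner_dual_bound[OF F_s in_L2[OF Qu]] by (simp add: \<phi>_def)
          also have "\<dots> \<le> \<phi> s * (c * Y s)"
            by (rule mult_left_mono[OF Q_norm[OF s] \<phi>_nonneg])
          finally show ?thesis .
        qed
        then have "\<alpha> / 3 * L2_inner \<Omega> (F s) (Q (u s)) \<le> \<alpha> / 3 * (\<phi> s * (c * Y s))"
          using \<alpha>(1) by (intro mult_left_mono) auto
        ultimately show ?thesis
          by (simp add: work_def algebra_simps)
      qed
    qed
    finally show ?thesis
      by (simp add: G_def E_XY)
  qed

  have G_E: "\<bar>G s - E s\<bar> \<le> E s / 6" if s: "s \<ge> 0" for s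
  proof -
    have "\<bar>G s - E s\<bar> = \<alpha> / 3 * \<bar>p s\<bar>"
      using \<alpha>(1) by (simp add: G_def abs_mult)
    also have "\<dots> \<le> \<alpha> / 3 * (c * X s * Y s)"
      using \<alpha>(1) by (intro mult_left_mono p_bound s) auto
    also have "\<dots> = (\<alpha> * c) * (X s * Y s) / 3"
      by simp
    also have "\<dots> \<le> 1 / 2 * (X s * Y s) / 3"
      using \<alpha>c X_nonneg Y_nonneg by (intro divide_right_mono mult_right_mono) auto
    also have "\<dots> \<le> E s / 6"
      using sum_squares_bound[of "X s" "Y s"] by (simp add: E_XY)
    finally show ?thesis .
  qed
  have E_nonneg: "0 \<le> E s" for s
    by (simp add: E_XY)
  define J where "J = integral {0..t} (\<lambda>s. exp (\<alpha> / 3 * (s - t)) * (\<phi> s)\<^sup>2)"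
  have J_nonneg: "0 \<le> J"
    unfolding J_def
    by (cases "(\<lambda>s. exp (\<alpha> / 3 * (s - t)) * (\<phi> s)\<^sup>2) integrable_on {0..t}")
      (auto simp: not_integrable_integral intro!: Henstock_Kurzweil_Integration.integral_nonneg)
  have "G t \<le> exp (- (\<alpha> / 3) * t) * G 0 + 5 / (12 * \<alpha>) * J"
    unfolding J_def by (rule damped_Gronwall[OF G_deriv G'_bound]) (use F(2)[OF t] t in \<open>auto simp: \<phi>_def\<close>)
  also have "exp (- (\<alpha> / 3) * t) * G 0 \<le> exp (- (\<alpha> / 3) * t) * (7 / 6 * E 0)"
  proof (rule mult_left_mono)
    show "G 0 \<le> 7 / 6 * E 0"
      using G_E[OF order_refl] by linarith
  qed simp
  finally have G_t: "G t \<le> 7 / 6 * (exp (- (\<alpha> / 3) * t) * E 0) + 5 / (12 * \<alpha>) * J"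
    by simp
  have "E t \<le> 6 / 5 * G t"
    using G_E[OF t] by linarith
  also have "\<dots> \<le> 6 / 5 * (7 / 6 * (exp (- (\<alpha> / 3) * t) * E 0) + 5 / (12 * \<alpha>) * J)"
    using G_t by (rule mult_left_mono) simp
  also have "\<dots> = 7 / 5 * (exp (- (\<alpha> / 3) * t) * E 0) + 1 / (2 * \<alpha>) * J"
    using \<alpha>(1) by (simp add: field_simps)
  also have "\<dots> \<le> 3 * (exp (- (\<alpha> / 3) * t) * E 0) + K / \<alpha> * J"
  proof (rule add_mono)
    show "7 / 5 * (exp (- (\<alpha> / 3) * t) * E 0) \<le> 3 * (exp (- (\<alpha> / 3) * t) * E 0)"
      using E_nonneg by (intro mult_right_mono) auto
    have "1 / 2 \<le> K"
      using constants by (simp add: K)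
    then have "1 / 2 / \<alpha> \<le> K / \<alpha>"
      using \<alpha>(1) by (intro divide_right_mono) auto
    then show "1 / (2 * \<alpha>) * J \<le> K / \<alpha> * J"
      using J_nonneg by (intro mult_right_mono) simp_all
  qed
  finally show ?thesis
    by (simp add: J_def \<phi>_def mult.assoc)
qed

end
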